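(* Consider the $t$-threshold scheme with $t$ a positive integer. Then, with suprema over all Borel sets $A\subseteq\mathbb{R}^d$, \[ \sup_{A}\bigl|\overline{\mathbb{Q}}_t(A)-\mathbb{Q}(A)\bigr|\le c_2(t)\,(t/m)^{-3/2},\qquad c_2(t):=\frac{\sqrt{\tfrac43\,\mathbb{E}[M^3]\,\mathbb{E}[M^2]\,\bigl(m+\mathbb{E}[M^2]/t\bigr)}}{m^{3}}, \] and \[ \sup_{A}\mathbb{E}\bigl|\widehat{\mathbb{Q}}_{N(t)}(A)-\mathbb{Q}(A)\bigr|\le \tilde c_2(t)\,(t/m)^{-1/2},\qquad \tilde c_2(t):=\frac{\sqrt{\mathbb{E}[M^2]}}{m}+\frac{\mathbb{E}[M^2]}{m^{3/2}\sqrt t}, \] where $c_2(t)$ and $\tilde c_2(t)$ are bounded uniformly in $t$.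
   Context: Standing setup (generalized splitting, GS). Let $f$ be a probability density on $\mathbb{R}^d$, let $S:\mathbb{R}^d\to\mathbb{R}$ be measurable, and let $\gamma\in\mathbb{R}$ be such that $\mathbb{P}(S(\mathbf{X})\ge\gamma)>0$ for $\mathbf{X}\sim f$. Fix an integer splitting factor $s\ge 2$, an integer $\tau\ge 1$ and levels $-\infty=\gamma_0<\gamma_1<\dots<\gamma_\tau=\gamma$. For each $l=0,\dots,\tau$ let $\kappa_l(\mathrm{d}\mathbf{y}\mid\mathbf{x})$ be a Markov transition kernel on $\mathbb{R}^d$ whose stationary distribution has density $q_l(\mathbf{y})=f(\mathbf{y})\mathbb{I}\{S(\mathbf{y})\ge\gamma_l\}/\mathbb{P}(S(\mathbf{X})\ge\gamma_l)$. One GS trial is: generate $\mathbf{Y}\sim f$; if $S(\mathbf{Y})<\gamma_1$, return the empty multiset. Otherwise set $\mathcal{X}_1=\{\mathbf{Y}\}$ and for $l=2,\dots,\tau$: set $\mathcal{X}_l=\emptyset$, and for every $\mathbf{Y}\in\mathcal{X}_{l-1}$ put $\mathbf{Y}_0=\mathbf{Y}$ and for $j=1,\dots,s$ sample $\mathbf{Y}_j\sim\kappa_{l-1}(\cdot\mid\mathbf{Y}_{j-1})$ (with fresh independent randomness) and add $\mathbf{Y}_j$ to $\mathcal{X}_l$ if $S(\mathbf{Y}_j)\ge\gamma_l$. The trial returns the multiset $\mathcal{X}_\tau$. A non-empty trial repeats independent GS trials until the returned multiset is non-empty and outputs that multiset $\mathcal{Y}$. Let $M=|\mathcal{Y}|$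 (counted with multiplicity), so $1\le M\le s^{\tau-1}$, and for measurable $A$ let $H(A)=|\mathcal{Y}\cap A|$ be the number of elements of $\mathcal{Y}$ (with multiplicity) lying in $A$. Write $m=\mathbb{E}[M]$ and $\operatorname{Var}(M)$ for the variance of $M$. The target distribution is $\mathbb{Q}(A)=\mathbb{P}(\mathbf{X}\in A\mid S(\mathbf{X})\ge\gamma)$, $\mathbf{X}\sim f$. Let $\mathcal{Y}_1,\mathcal{Y}_2,\dots$ be independent non-empty trials with corresponding $M_i$ and $H_i(A)$. $t$-threshold scheme: let $T_0=0$, $T_i=M_1+\dots+M_i$, $N(t)=\min\{i\ge1:T_i>t\}$, $\widehat{\mathbb{Q}}_{N(t)}(A)=\sum_{i=1}^{N(t)}H_i(A)\big/T_{N(t)}$ (the empirical distribution of $\mathcal{Y}_1\cup\dots\cup\mathcal{Y}_{N(t)}$), and $\overline{\mathbb{Q}}_t(A)=\mathbb{E}[\widehat{\mathbb{Q}}_{N(t)}(A)]$. *)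

theory Defs
  imports "HOL-Probability.Probability"
begin

text \<open>Generalized splitting (GS).  Since all quantities in the theorem only depend on
the pair (M, H(A)) = (size of the output multiset, number of its elements in A), a GS trial
is described, for a fixed Borel set A, by the joint law of (M, H(A)) on nat x nat.\<close>

definition cnt :: "(nat \<times> nat) measure" where
  "cnt = count_space UNIV"

definition gs_dist :: "('a::euclidean_space \<Rightarrow> real) \<Rightarrow> 'a measure" where
  "gs_dist f = density lborel (\<lambda>x. ennreal (f x))"

text \<open>Level sets {S >= gamma_l}, with gamma_0 = -infinity.\<close>
definition gs_lvl :: "('a \<Rightarrow> real) \<Rightarrow> (nat \<Rightarrow> real) \<Rightarrow> nat \<Rightarrow> 'a set" where
  "gs_lvl S lev l = (if l = 0 then UNIV else {y. lev l \<le> S y})"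

definition gs_target ::
  "('a::euclidean_space \<Rightarrow> real) \<Rightarrow> ('a \<Rightarrow> real) \<Rightarrow> (nat \<Rightarrow> real) \<Rightarrow> nat \<Rightarrow> 'a measure" where
  "gs_target f S lev l = density lborel
     (\<lambda>y. ennreal (f y * indicator (gs_lvl S lev l) y / measure (gs_dist f) (gs_lvl S lev l)))"

definition gs_Q :: "('a::euclidean_space \<Rightarrow> real) \<Rightarrow> ('a \<Rightarrow> real) \<Rightarrow> real \<Rightarrow> 'a set \<Rightarrow> real" where
  "gs_Q f S gam A = measure (gs_dist f) (A \<inter> {x. gam \<le> S x}) / measure (gs_dist f) {x. gam \<le> S x}"

text \<open>The Markov chain Y_1,...,Y_n started at x with kernel k; each Y_j satisfying P is
kept and spawns an (independent given Y_j) subtree with count-law sub Y_j.  Result: the law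
of the summed counts.\<close>
primrec gs_chain :: "('a \<Rightarrow> 'a measure) \<Rightarrow> ('a \<Rightarrow> bool) \<Rightarrow> ('a \<Rightarrow> (nat \<times> nat) measure)
    \<Rightarrow> nat \<Rightarrow> 'a \<Rightarrow> (nat \<times> nat) measure" where
  "gs_chain k P sub 0 x = return cnt (0, 0)"
| "gs_chain k P sub (Suc n) x =
     k x \<bind> (\<lambda>y. (if P y then sub y else return cnt (0, 0)) \<bind>
       (\<lambda>c. gs_chain k P sub n y \<bind> (\<lambda>c'. return cnt (fst c + fst c', snd c + snd c'))))"

text \<open>gs_desc s S lev K A l r x: law of (number of descendants in the final multiset,
number of those lying in A) of a particle x belonging to X_l, with r = tau - l levels remaining.
A particle of X_l moves with kernel kappa_l and its children enter X_(l+1) iff S >= gamma_(l+1).\<close>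
fun gs_desc :: "nat \<Rightarrow> ('a \<Rightarrow> real) \<Rightarrow> (nat \<Rightarrow> real) \<Rightarrow> (nat \<Rightarrow> 'a \<Rightarrow> 'a measure) \<Rightarrow> 'a set
    \<Rightarrow> nat \<Rightarrow> nat \<Rightarrow> 'a \<Rightarrow> (nat \<times> nat) measure" where
  "gs_desc s S lev K A l 0 x = return cnt (1, if x \<in> A then 1 else 0)"
| "gs_desc s S lev K A l (Suc r) x =
     gs_chain (K l) (\<lambda>y. lev (Suc l) \<le> S y) (gs_desc s S lev K A (Suc l) r) s x"

definition gs_trial :: "('a::euclidean_space \<Rightarrow> real) \<Rightarrow> nat \<Rightarrow> nat \<Rightarrow> ('a \<Rightarrow> real)
    \<Rightarrow> (nat \<Rightarrow> real) \<Rightarrow> (nat \<Rightarrow> 'a \<Rightarrow> 'a measure) \<Rightarrow> 'a set \<Rightarrow> (nat \<times> nat) measure" where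
  "gs_trial f s \<tau> S lev K A =
     gs_dist f \<bind> (\<lambda>y. if lev 1 \<le> S y then gs_desc s S lev K A 1 (\<tau> - 1) y else return cnt (0, 0))"

text \<open>Non-empty trial (repeat independent trials until non-empty): the law of a trial
conditioned on M >= 1.\<close>
definition gs_nonempty :: "('a::euclidean_space \<Rightarrow> real) \<Rightarrow> nat \<Rightarrow> nat \<Rightarrow> ('a \<Rightarrow> real)
    \<Rightarrow> (nat \<Rightarrow> real) \<Rightarrow> (nat \<Rightarrow> 'a \<Rightarrow> 'a measure) \<Rightarrow> 'a set \<Rightarrow> (nat \<times> nat) measure" where
  "gs_nonempty f s \<tau> S lev K A = uniform_measure (gs_trial f s \<tau> S lev K A) {c. 1 \<le> fst c}"

text \<open>Moments E[M^k] of a non-empty trial (the law of M does not depend on A; take A = UNIV).\<close>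
definition gs_moment :: "('a::euclidean_space \<Rightarrow> real) \<Rightarrow> nat \<Rightarrow> nat \<Rightarrow> ('a \<Rightarrow> real)
    \<Rightarrow> (nat \<Rightarrow> real) \<Rightarrow> (nat \<Rightarrow> 'a \<Rightarrow> 'a measure) \<Rightarrow> nat \<Rightarrow> real" where
  "gs_moment f s \<tau> S lev K k = (\<integral>c. real (fst c) ^ k \<partial>(gs_nonempty f s \<tau> S lev K UNIV))"

text \<open>t-threshold scheme on a sequence omega i = (M_(i+1), H_(i+1)(A)) of non-empty trials:
T_i = M_1 + ... + M_i, N(t) = min{i >= 1. T_i > t}, and the estimator
sum_(i <= N(t)) H_i(A) / T_N(t).\<close>
definition thr_T :: "(nat \<Rightarrow> nat \<times> nat) \<Rightarrow> nat \<Rightarrow> nat" where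
  "thr_T \<omega> i = (\<Sum>j<i. fst (\<omega> j))"

definition thr_N :: "(nat \<Rightarrow> nat \<times> nat) \<Rightarrow> nat \<Rightarrow> nat" where
  "thr_N \<omega> t = (LEAST i. 1 \<le> i \<and> t < thr_T \<omega> i)"

definition thr_est :: "(nat \<Rightarrow> nat \<times> nat) \<Rightarrow> nat \<Rightarrow> real" where
  "thr_est \<omega> t = real (\<Sum>j<thr_N \<omega> t. snd (\<omega> j)) / real (thr_T \<omega> (thr_N \<omega> t))"

definition gs_seq :: "('a::euclidean_space \<Rightarrow> real) \<Rightarrow> nat \<Rightarrow> nat \<Rightarrow> ('a \<Rightarrow> real)
    \<Rightarrow> (nat \<Rightarrow> real) \<Rightarrow> (nat \<Rightarrow> 'a \<Rightarrow> 'a measure) \<Rightarrow> 'a set \<Rightarrow> (nat \<Rightarrow> nat \<times> nat) measure" where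
  "gs_seq f s \<tau> S lev K A = PiM UNIV (\<lambda>_. gs_nonempty f s \<tau> S lev K A)"

end

theory Submission
  imports Defs
begin

text \<open>With \<open>q = Q(A)\<close>, stationarity of the kernels makes a nonempty trial unbiased:
  \<open>E[H] = q E[M]\<close>.  Hence \<open>W = \<Sum>i\<le>N. (H\<^sub>i - q M\<^sub>i)\<close> has mean zero and \<open>E[W\<^sup>2] \<le> E[M\<^sup>2] E[N]\<close>
  by Wald's identities.  The estimation error is \<open>W / (t + R)\<close>, where \<open>R\<close> is the overshoot
  of the renewal process over \<open>t\<close>.  Its mean absolute value is at most \<open>E\<bar>W\<bar> / t\<close>; its mean is
  unchanged by subtracting \<open>W / t\<close>, so it is at most \<open>E[\<bar>W\<bar> R] / t\<^sup>2\<close>, and the Cauchy-Schwarz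
  inequality applies.  The remaining inputs are Lorden's inequalities
  \<open>E[R] \<le> E[M\<^sup>2] / m\<close> and \<open>E[R\<^sup>2] \<le> 4/3 E[M\<^sup>3] / m\<close>.\<close>

section \<open>Lorden's inequalities for integer-valued renewal processes\<close>

text \<open>Expectations such as E[N], E[R], E[R^2] and E[\<open>W^2\<close>] all solve an equation
  \<open>a t = b t + conv a t\<close>, whose source \<open>b\<close> describes what the first trial
  contributes. A nonempty trial has at least one point, so steps are positive: the equation
  determines \<open>a\<close> by recursion on \<open>t\<close>, and a nonnegative source forces a
  nonnegative solution. Wald's identities thus reduce to matching sources, and the monotonicity,
  subadditivity and Jensen steps behind Lorden's bounds reduce to nonnegative sources; no limit
  theorem enters. At most \<open>s ^ (\<tau> - 1)\<close> points per trial keep all sums finite. The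
  factor 4/3 is 1 + 1/3: the 1/3 comes from weighting window lengths below k by odd numbers, the 1
  from the initial excess of each window after Cauchy-Schwarz. The constants must not depend on A
  although the law of (M, H(A)) does; hence the centred summand is bounded by M alone, and the law
  of M is shown to be the same for every A.\<close>

locale discrete_renewal =
  fixes p :: "nat \<Rightarrow> real" and B :: nat and U :: "nat \<Rightarrow> real"
  assumes p_nonneg: "0 \<le> p k" and p_zero: "p 0 = 0" and p_sum: "(\<Sum>k\<le>B. p k) = 1"
    and U_renewal: "U t = 1 + (\<Sum>k\<le>B. p k * (if k \<le> t then U (t - k) else 0))"
begin

definition conv :: "(nat \<Rightarrow> real) \<Rightarrow> nat \<Rightarrow> real" where
  "conv a t = (\<Sum>k\<le>B. p k * (if k \<le> t then a (t - k) else 0))"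

definition mom :: "nat \<Rightarrow> real" where
  "mom n = (\<Sum>k\<le>B. p k * real k ^ n)"

lemma U_eq: "U t = 1 + conv U t"
  using U_renewal unfolding conv_def .

lemma const_eq: "(\<Sum>k\<le>B. p k * c) = c"
  using p_sum by (simp flip: sum_distrib_right)

text \<open>Comparison principle. Since \<open>p 0 = 0\<close>, \<open>conv a t\<close> involves
  \<open>a\<close> only at times before \<open>t\<close>, so strong induction applies. An inequality
  is proved by exhibiting a nonnegative source for the difference of its sides.\<close>

lemma renewal_nonneg:
  assumes "\<And>t. a t = b t + conv a t" and "\<And>t. 0 \<le> b t"
  shows "0 \<le> a t"
proof (induction t rule: less_induct)
  case (less t)
  have "0 \<le> p k * (if k \<le> t then a (t - k) else 0)" for k
    using less[of "t - k"] p_nonneg[of k] p_zero by (cases "k = 0") auto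
  then have "0 \<le> conv a t"
    unfolding conv_def by (intro sum_nonneg) auto
  then show ?case
    using assms by (metis add_nonneg_nonneg)
qed

lemma conv_add: "conv (\<lambda>t. a t + b t) t = conv a t + conv b t"
  unfolding conv_def sum.distrib[symmetric] by (intro sum.cong) (auto simp: algebra_simps)

lemma conv_cmult: "conv (\<lambda>t. c * a t) t = c * conv a t"
  unfolding conv_def sum_distrib_left by (intro sum.cong) (auto simp: algebra_simps)

lemma conv_diff: "conv (\<lambda>t. a t - b t) t = conv a t - conv b t"
  unfolding conv_def sum_subtractf[symmetric] by (intro sum.cong) (auto simp: algebra_simps)

lemma conv_sum: "conv (\<lambda>t. \<Sum>i\<in>I. a i t) t = (\<Sum>i\<in>I. conv (a i) t)"
  unfolding conv_def
  by (subst sum.swap) (auto intro!: sum.cong simp: sum_distrib_left if_distrib[of "\<lambda>x. _ * x"])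

text \<open>The difference of two solutions has source 0 in both orders, so the comparison principle
  gives both inequalities.\<close>

lemma renewal_unique:
  assumes a: "\<And>t. a t = b t + conv a t" and a': "\<And>t. a' t = b t + conv a' t"
  shows "a t = a' t"
proof -
  have "a t - a' t = 0 + conv (\<lambda>t. a t - a' t) t" "a' t - a t = 0 + conv (\<lambda>t. a' t - a t) t" for t
    unfolding conv_diff using a[of t] a'[of t] by simp_all
  from this[THEN renewal_nonneg] have "0 \<le> a t - a' t" "0 \<le> a' t - a t"
    by simp_all
  then show ?thesis by simp
qed

section \<open>Monotonicity and subadditivity of the renewal function\<close>

lemma U_nonneg: "0 \<le> U t"
  by (rule renewal_nonneg[OF U_eq]) simp

lemma U_ge_1: "1 \<le> U t"
proof -
  have "0 \<le> conv U t"
    unfolding conv_def by (intro sum_nonneg) (auto intro!: mult_nonneg_nonneg p_nonneg U_nonneg)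
  then show ?thesis using U_eq[of t] by simp
qed

lemma U_mono_Suc: "U t \<le> U (Suc t)"
proof -
  have "0 \<le> U (Suc t) - U t"
  \<comment> \<open>The source is what a first step of exactly \<open>Suc t\<close> adds: it does
    not cross \<open>Suc t\<close>, but it crosses \<open>t\<close>.\<close>
  proof (rule renewal_nonneg[where b = "\<lambda>t. \<Sum>k\<le>B. p k * (if k = Suc t then U 0 else 0)"])
    show "0 \<le> (\<Sum>k\<le>B. p k * (if k = Suc t then U 0 else 0))" for t
      by (intro sum_nonneg) (auto intro!: mult_nonneg_nonneg p_nonneg U_nonneg)
    show "U (Suc t) - U t = (\<Sum>k\<le>B. p k * (if k = Suc t then U 0 else 0)) +
        conv (\<lambda>t. U (Suc t) - U t) t" for t
      unfolding U_eq[of t] U_eq[of "Suc t"] conv_def add_diff_cancel_left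
        sum_subtractf[symmetric] sum.distrib[symmetric]
      by (intro sum.cong) (auto simp: algebra_simps Suc_diff_le)
  qed
  then show ?thesis by simp
qed

lemma U_mono: "s \<le> t \<Longrightarrow> U s \<le> U t"
  using U_mono_Suc by (rule lift_Suc_mono_le)

text \<open>From the first renewal after time \<open>s\<close> on, the process starts afresh with at most
  \<open>t\<close> time units left.\<close>

lemma U_subadd: "U (s + t + 1) \<le> U s + U t"
proof -
  \<comment> \<open>Only steps \<open>k > s\<close> leave a source. On integers this means
    \<open>k \<ge> s + 1\<close>, so the remaining time \<open>s + t + 1 - k\<close> is at most
    \<open>t\<close> and monotonicity applies; this is where the \<open>+ 1\<close> in the statement
    fits.\<close>
  let ?b = "\<lambda>s. \<Sum>k\<le>B. p k * (if k \<le> s then 0 else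
      if k \<le> s + t + 1 then U t - U (s + t + 1 - k) else U t)"
  have "0 \<le> U s + U t - U (s + t + 1)"
  proof (rule renewal_nonneg[where b = ?b and a = "\<lambda>s. U s + U t - U (s + t + 1)"])
    show "0 \<le> ?b s" for s
      by (intro sum_nonneg) (auto intro!: mult_nonneg_nonneg p_nonneg U_nonneg U_mono)
    fix s
    have "U s + U t - U (s + t + 1)
        = conv U s + (\<Sum>k\<le>B. p k * U t) - conv U (s + t + 1)"
      using U_eq[of s] U_eq[of "s + t + 1"] const_eq[of "U t"] by simp
    also have "\<dots> = ?b s + conv (\<lambda>s. U s + U t - U (s + t + 1)) s"
      unfolding conv_def sum_subtractf[symmetric] sum.distrib[symmetric]
      by (intro sum.cong) (auto simp: algebra_simps Suc_diff_le)
    finally show "U s + U t - U (s + t + 1) = ?b s + conv (\<lambda>s. U s + U t - U (s + t + 1)) s" .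
  qed
  then show ?thesis by simp
qed

text \<open>By Wald's identity, \<open>excess t\<close> is the mean overshoot over \<open>t\<close>.\<close>

definition excess :: "nat \<Rightarrow> real" where
  "excess t = mom 1 * U t - real t"

text \<open>The truncated difference \<open>k - t\<close> is the overshoot when the first step
  already crosses \<open>t\<close>. A real difference of \<open>k\<close> and \<open>t\<close> is
  this positive part plus the negated remaining time \<open>t - k\<close>, and the latter is
  absorbed by \<open>conv\<close>.\<close>

lemma excess_renewal: "excess t = (\<Sum>k\<le>B. p k * real (k - t)) + conv excess t"
proof -
  have "mom 1 - real t = (\<Sum>k\<le>B. p k * (real k - real t))"
    using const_eq[of "real t"] by (simp add: mom_def sum_subtractf right_diff_distrib)
  also have "\<dots> = (\<Sum>k\<le>B. p k * real (k - t)) + conv (\<lambda>s. - real s) t"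
    unfolding conv_def sum.distrib[symmetric]
    by (intro sum.cong) (auto simp: algebra_simps of_nat_diff)
  finally have "excess t = (\<Sum>k\<le>B. p k * real (k - t)) + conv (\<lambda>s. mom 1 * U s + - real s) t"
    unfolding excess_def conv_add conv_cmult using U_eq[of t] by (simp add: algebra_simps)
  then show ?thesis by (simp add: excess_def[abs_def])
qed

lemma conv_partial_sum: "conv (\<lambda>t. \<Sum>u<t. a u) t = (\<Sum>v<t. conv a v)"
proof -
  have "(if k \<le> t then \<Sum>u<t-k. a u else 0) = (\<Sum>v<t. if k \<le> v then a (v - k) else 0)" for k
  proof (cases "k \<le> t")
    case True
    have "(\<Sum>v<t. if k \<le> v then a (v - k) else 0) = (\<Sum>v\<in>{k..<t}. a (v - k))"
      by (intro sum.mono_neutral_cong_right) auto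
    also have "\<dots> = (\<Sum>u<t-k. a u)"
      by (rule sum.reindex_bij_witness[of _ "\<lambda>u. u + k" "\<lambda>v. v - k"]) (use True in auto)
    finally show ?thesis using True by simp
  qed simp
  then show ?thesis
    unfolding conv_def by (simp add: sum_distrib_left) (rule sum.swap)
qed

text \<open>A function \<open>h\<close> with the renewal equation assumed below is the second moment of the
  overshoot \<open>R\<close>.  Pathwise, the first identity reads
  \<open>R\<^sub>t\<^sup>2 + R\<^sub>t + 2 (\<Sum>u<t. R\<^sub>u) = (\<Sum>i. X\<^sub>i (X\<^sub>i + 1))\<close>, summed over the steps \<open>X\<^sub>i\<close>
  up to the crossing of \<open>t\<close>.\<close>

lemma second_moment_identity:
  assumes "\<And>t. h t = (\<Sum>k\<le>B. p k * real (k - t) ^ 2) + conv h t"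
  shows "h t = (mom 2 + mom 1) * U t - excess t - 2 * (\<Sum>u<t. excess u)"
proof (rule renewal_unique[OF assms])
  fix t
  \<comment> \<open>The pathwise identity for a single step \<open>k\<close>, with positive parts as
    overshoots. Averaged over \<open>p\<close> it matches the sources of both sides, and uniqueness
    does the rest.\<close>
  have *: "real (k - t) ^ 2 + real (k - t) + 2 * (\<Sum>v<t. real (k - v)) = real k ^ 2 + real k" for k
  proof (induction t)
    case (Suc t)
    then show ?case
      by (cases "k \<le> t") (auto simp: of_nat_diff power2_eq_square algebra_simps)
  qed simp
  have "mom 2 + mom 1 = (\<Sum>k\<le>B. p k * (real (k - t) ^ 2 + real (k - t) + 2 * (\<Sum>v<t. real (k - v))))"
    unfolding * mom_def sum.distrib[symmetric] by (simp add: algebra_simps)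
  also have "\<dots> = (\<Sum>k\<le>B. p k * real (k - t) ^ 2) + (\<Sum>k\<le>B. p k * real (k - t))
      + 2 * (\<Sum>k\<le>B. \<Sum>v<t. p k * real (k - v))"
    by (simp add: sum.distrib distrib_left sum_distrib_left algebra_simps)
  also have "(\<Sum>k\<le>B. \<Sum>v<t. p k * real (k - v)) = (\<Sum>v<t. excess v - conv excess v)"
    using excess_renewal by (subst sum.swap) (simp add: eq_diff_eq)
  finally have "mom 2 + mom 1 = (\<Sum>k\<le>B. p k * real (k - t) ^ 2) + (excess t - conv excess t)
      + 2 * (\<Sum>v<t. excess v - conv excess v)"
    using excess_renewal[of t] by simp
  moreover have "(mom 2 + mom 1) * U t = (mom 2 + mom 1) + (mom 2 + mom 1) * conv U t"
    by (subst U_eq) (simp add: algebra_simps)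
  ultimately show "(mom 2 + mom 1) * U t - excess t - 2 * (\<Sum>u<t. excess u)
      = (\<Sum>k\<le>B. p k * real (k - t) ^ 2)
        + conv (\<lambda>t. (mom 2 + mom 1) * U t - excess t - 2 * (\<Sum>u<t. excess u)) t"
    unfolding conv_diff conv_cmult conv_partial_sum sum_subtractf by simp
qed

text \<open>Jensen's inequality for the overshoot, carried out on renewal equations: E[(R - c)^2]
  has the source \<open>p k * (real (k - t) - c) ^ 2\<close> over crossing steps. The constant
  \<open>c\<close> is the mean at the target time and stays frozen while the time in the equation
  varies.\<close>

lemma second_moment_ge_square:
  assumes "\<And>t. h t = (\<Sum>k\<le>B. p k * real (k - t) ^ 2) + conv h t"
  shows "excess t ^ 2 \<le> h t"
proof -
  define c where "c = excess t"
  let ?b = "\<lambda>t. \<Sum>k\<le>B. p k * (if k \<le> t then 0 else (real (k - t) - c) ^ 2)"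
  have "0 \<le> h t + (c ^ 2 - 2 * c * excess t)"
  proof (rule renewal_nonneg[where b = ?b])
    show "0 \<le> ?b t" for t
      by (intro sum_nonneg) (auto intro!: mult_nonneg_nonneg p_nonneg)
    fix t
    have "?b t = (\<Sum>k\<le>B. p k * real (k - t) ^ 2) + (\<Sum>k\<le>B. p k * c ^ 2) - conv (\<lambda>_. c ^ 2) t
        - 2 * c * (\<Sum>k\<le>B. p k * real (k - t))"
      unfolding conv_def sum_distrib_left sum.distrib[symmetric] sum_subtractf[symmetric]
      by (intro sum.cong) (auto simp: power2_eq_square algebra_simps)
    also have "(\<Sum>k\<le>B. p k * real (k - t)) = excess t - conv excess t"
      using excess_renewal[of t] by simp
    also have "(\<Sum>k\<le>B. p k * real (k - t) ^ 2) = h t - conv h t"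
      using assms[of t] by simp
    finally show "h t + (c ^ 2 - 2 * c * excess t) = ?b t + conv (\<lambda>t. h t + (c ^ 2 - 2 * c * excess t)) t"
      unfolding conv_add conv_diff conv_cmult const_eq by (simp add: algebra_simps)
  qed
  then show ?thesis by (simp add: c_def power2_eq_square)
qed

lemma mom_1_ge: "1 \<le> mom 1"
proof -
  have "(\<Sum>k\<le>B. p k) \<le> mom 1"
    unfolding mom_def
  proof (intro sum_mono)
    show "p k \<le> p k * real k ^ 1" for k
      using mult_left_mono[of 1 "real k" "p k"] p_nonneg[of k] p_zero by (cases "k = 0") auto
  qed
  then show ?thesis by (simp add: p_sum)
qed

lemma mom_nonneg: "0 \<le> mom n"
  unfolding mom_def by (intro sum_nonneg mult_nonneg_nonneg p_nonneg) auto

text \<open>The first-moment case of Lorden's inequality, following Carlsson and Nerman: subadditivity bounds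
  \<open>t * excess t\<close> by twice the sum of the excesses before \<open>t\<close>, which the identity above computes.\<close>

lemma excess_le:
  assumes h: "\<And>t. h t = (\<Sum>k\<le>B. p k * real (k - t) ^ 2) + conv h t"
  shows "excess t \<le> mom 2 / mom 1"
proof -
  let ?m = "mom 1" and ?r = "excess t"
  have m: "?m > 0" using mom_1_ge by simp
  have U: "U s = (excess s + s) / ?m" for s
    using m by (simp add: excess_def)
  \<comment> \<open>The paired times \<open>s\<close> and \<open>t - 1 - s\<close> add up to
    \<open>t - 1\<close> only, so passing from \<open>U\<close> to \<open>excess\<close> gains 1 per
    pair. The resulting extra \<open>t\<close> cancels the one that appears when
    \<open>mom 1 * U t\<close> is expanded at the end of the chain.\<close>
  have "real t * ?r + real t \<le> (\<Sum>s<t. excess s + excess (t - 1 - s))"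
  proof -
    have "?r + 1 \<le> excess s + excess (t - 1 - s)" if "s < t" for s
    proof -
      have "U t \<le> U s + U (t - 1 - s)"
        using U_subadd[of s "t - 1 - s"] that by simp
      then have "?m * U t \<le> ?m * U s + ?m * U (t - 1 - s)"
        using m by (simp flip: distrib_left)
      then show ?thesis
        using that by (simp add: excess_def of_nat_diff)
    qed
    then have "(\<Sum>s<t. ?r + 1) \<le> (\<Sum>s<t. excess s + excess (t - 1 - s))"
      by (intro sum_mono) auto
    then show ?thesis by (simp add: algebra_simps)
  qed
  also have "\<dots> = 2 * (\<Sum>s<t. excess s)"
    using sum.nat_diff_reindex[of excess t] by (simp add: sum.distrib)
  also have "\<dots> = (mom 2 + ?m) * U t - ?r - h t"
    using second_moment_identity[OF h, of t] by simp
  also have "\<dots> \<le> (mom 2 + ?m) * U t - ?r - ?r ^ 2"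
    using second_moment_ge_square[OF h, of t] by simp
  also have "\<dots> = mom 2 / ?m * (?r + t) + t - ?r ^ 2"
    using m by (simp add: U field_simps)
  finally have "(?r + t) * (?r - mom 2 / ?m) \<le> 0"
    by (simp add: algebra_simps power2_eq_square)
  moreover have "?r + t > 0"
    using m U_ge_1[of t] by (simp add: excess_def)
  ultimately show ?thesis
    by (simp add: mult_le_0_iff)
qed

text \<open>Cauchy-Schwarz for the size-biased weights \<open>p k * k\<close>: \<open>?c\<close> is
  their mean, and the sum of weighted squared deviations from it is nonnegative.\<close>

lemma mom_2_squared_le: "mom 2 ^ 2 \<le> mom 1 * mom 3"
proof -
  let ?m = "mom 1" and ?c = "mom 2 / mom 1"
  have m: "?m > 0" using mom_1_ge by simp
  have "0 \<le> (\<Sum>k\<le>B. p k * (real k * (real k - ?c) ^ 2))"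
    by (intro sum_nonneg mult_nonneg_nonneg p_nonneg) auto
  also have "\<dots> = (\<Sum>k\<le>B. p k * real k ^ 3 - 2 * ?c * (p k * real k ^ 2) + ?c ^ 2 * (p k * real k ^ 1))"
    by (intro sum.cong) (auto simp: power2_eq_square power3_eq_cube algebra_simps
        simp del: times_divide_eq_left times_divide_eq_right)
  also have "\<dots> = mom 3 - 2 * ?c * mom 2 + ?c ^ 2 * mom 1"
    unfolding mom_def by (simp add: sum.distrib sum_subtractf sum_distrib_left)
  also have "\<dots> = mom 3 - mom 2 ^ 2 / mom 1"
    using m by (simp add: power2_eq_square field_simps)
  finally show ?thesis using m by (simp add: field_simps)
qed

text \<open>\<open>D t\<close> counts the expected renewals in the window of the last \<open>w + 1\<close> time points.\<close>

lemma window_renewal: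
  fixes w :: nat
  defines "D \<equiv> \<lambda>t. U t - (if w < t then U (t - Suc w) else 0)"
  shows "D t = (if t \<le> w then 1 else 0) + conv D t"
proof -
  have "(if w < t then U (t - Suc w) else 0)
      = (if w < t then 1 else 0) + conv (\<lambda>t. if w < t then U (t - Suc w) else 0) t"
  proof (cases "w < t")
    case True
    have "conv U (t - Suc w) = conv (\<lambda>t. if w < t then U (t - Suc w) else 0) t"
      unfolding conv_def using True by (intro sum.cong) (auto simp: Suc_diff_le add.commute)
    then show ?thesis using True U_eq[of "t - Suc w"] by simp
  qed (auto simp: conv_def intro!: sum.neutral)
  then show ?thesis
    unfolding D_def conv_diff using U_eq[of t] by simp
qed

text \<open>The second-moment case of Lorden's inequality: writing the squared overshoot as a sum of odd
  numbers turns \<open>h\<close> into a combination of window counts, each bounded by subadditivity.\<close>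

lemma second_moment_le:
  assumes h: "\<And>t. h t = (\<Sum>k\<le>B. p k * real (k - t) ^ 2) + conv h t"
  shows "h t \<le> 4 / 3 * mom 3 / mom 1"
proof -
  let ?m = "mom 1"
  have m: "?m > 0" using mom_1_ge by simp
  define D where "D = (\<lambda>w t. U t - (if w < t then U (t - Suc w) else 0))"
  have D_le: "D w t \<le> real w / ?m + mom 2 / ?m ^ 2" for w
  proof -
    \<comment> \<open>For \<open>w < t\<close> subadditivity is used at \<open>t - Suc w\<close> and
      \<open>w\<close>, which with the extra 1 add up to \<open>t\<close>; otherwise the window
      covers all of time and monotonicity suffices.\<close>
    have "D w t \<le> U w"
    proof (cases "w < t")
      case True
      then show ?thesis using U_subadd[of "t - Suc w" w] by (simp add: D_def)
    qed (use U_mono[of t w] in \<open>simp add: D_def\<close>)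
    also have "\<dots> \<le> real w / ?m + mom 2 / ?m ^ 2"
      using excess_le[OF h, of w] m by (simp add: excess_def field_simps power2_eq_square)
    finally show ?thesis .
  qed
  \<comment> \<open>The odd numbers are indexed so that \<open>t\<close> enters only through
    \<open>t \<le> w\<close>, which is exactly the source of \<open>D w\<close>.\<close>
  have sq: "real (k - t) ^ 2 = (\<Sum>w<k. (2 * real (k - w) - 1) * (if t \<le> w then 1 else 0))" for k t
  proof (induction k)
    case (Suc k)
    have "(\<Sum>w<k. (2 * real (Suc k - w) - 1) * (if t \<le> w then 1 else 0::real))
        = (\<Sum>w<k. (2 * real (k - w) - 1) * (if t \<le> w then 1 else 0) + 2 * (if t \<le> w then 1 else 0))"
      by (intro sum.cong) (auto simp: of_nat_diff algebra_simps)
    also have "\<dots> = real (k - t) ^ 2 + 2 * (\<Sum>w<k. if t \<le> w then 1 else 0)"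
      unfolding sum.distrib Suc.IH sum_distrib_left ..
    also have "(\<Sum>w<k. if t \<le> w then 1 else 0::real) = (\<Sum>w\<in>{t..<k}. 1)"
      by (intro sum.mono_neutral_cong_right) auto
    finally show ?case
      by (cases "t \<le> k") (auto simp: Suc_diff_le power2_eq_square algebra_simps)
  qed simp
  have "h t = (\<Sum>k\<le>B. p k * (\<Sum>w<k. (2 * real (k - w) - 1) * D w t))"
  proof (rule renewal_unique[OF h])
    fix t
    have "conv (\<lambda>t. \<Sum>k\<le>B. p k * (\<Sum>w<k. (2 * real (k - w) - 1) * D w t)) t
        = (\<Sum>k\<le>B. p k * (\<Sum>w<k. (2 * real (k - w) - 1) * conv (D w) t))"
      unfolding conv_sum conv_cmult ..
    moreover have "D w t = (if t \<le> w then 1 else 0) + conv (D w) t" for w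
      unfolding D_def by (rule window_renewal)
    ultimately show "(\<Sum>k\<le>B. p k * (\<Sum>w<k. (2 * real (k - w) - 1) * D w t))
        = (\<Sum>k\<le>B. p k * real (k - t) ^ 2)
          + conv (\<lambda>t. \<Sum>k\<le>B. p k * (\<Sum>w<k. (2 * real (k - w) - 1) * D w t)) t"
      unfolding sq by (simp add: sum.distrib distrib_left)
  qed
  also have "\<dots> \<le> (\<Sum>k\<le>B. p k * (real k ^ 2 * (mom 2 / ?m ^ 2) + real k ^ 3 / (3 * ?m)))"
  proof (intro sum_mono mult_left_mono p_nonneg)
    fix k
    have "(\<Sum>w<k. (2 * real (k - w) - 1) * D w t)
        \<le> (\<Sum>w<k. (2 * real (k - w) - 1) * (real w / ?m + mom 2 / ?m ^ 2))"
      by (intro sum_mono mult_left_mono D_le) (auto simp: of_nat_diff)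
    also have "\<dots> = (\<Sum>w<k. 2 * real (k - w) - 1) * (mom 2 / ?m ^ 2)
        + (\<Sum>w<k. (2 * real (k - w) - 1) * real w) / ?m"
      by (simp add: distrib_left sum.distrib sum_distrib_right sum_divide_distrib)
    also have "(\<Sum>w<k. 2 * real (k - w) - 1) = real k ^ 2"
      using sq[of k 0] by simp
    also have "(\<Sum>w<k. (2 * real (k - w) - 1) * real w)
        = (2 * real k ^ 3 - 3 * real k ^ 2 + real k) / 6"
    proof -
      \<comment> \<open>The coefficient is frozen at \<open>n\<close>, so that the induction on the
        number of summands does not change the summands; \<open>n = k\<close> is inserted
        afterwards.\<close>
      have "(\<Sum>w<k. (2 * real n - 2 * real w - 1) * real w)
          = real k * (real k - 1) * (real n - 1 / 2 - (2 * real k - 1) / 3)" for n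
        by (induction k) (auto simp: field_simps)
      from this[of k] have "(\<Sum>w<k. (2 * real k - 2 * real w - 1) * real w)
          = (2 * real k ^ 3 - 3 * real k ^ 2 + real k) / 6"
        by (simp add: power2_eq_square power3_eq_cube field_simps)
      moreover have "(\<Sum>w<k. (2 * real (k - w) - 1) * real w) = (\<Sum>w<k. (2 * real k - 2 * real w - 1) * real w)"
        by (intro sum.cong) (auto simp: of_nat_diff)
      ultimately show ?thesis by simp
    qed
    also have "\<dots> / ?m \<le> (real k ^ 3 / 3) / ?m"
    proof (rule divide_right_mono)
      have "real k \<le> real k ^ 2"
        by (cases "k = 0") (auto simp: power2_eq_square simp flip: of_nat_mult)
      then have "real k \<le> 3 * real k ^ 2"
        using zero_le_power2[of "real k"] by linarith
      then show "(2 * real k ^ 3 - 3 * real k ^ 2 + real k) / 6 \<le> real k ^ 3 / 3"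
        by simp
    qed (use m in simp)
    finally show "(\<Sum>w<k. (2 * real (k - w) - 1) * D w t)
        \<le> real k ^ 2 * (mom 2 / ?m ^ 2) + real k ^ 3 / (3 * ?m)"
      by simp
  qed
  also have "\<dots> = mom 2 * (mom 2 / ?m ^ 2) + mom 3 / (3 * ?m)"
    unfolding mom_def[of 2] mom_def[of 3] sum_divide_distrib sum_distrib_right sum.distrib[symmetric]
    by (intro sum.cong) (auto simp: algebra_simps)
  \<comment> \<open>This term contributes 1 and the cubic term 1/3 to the factor 4/3.\<close>
  also have "mom 2 * (mom 2 / ?m ^ 2) \<le> mom 3 / ?m"
    using mom_2_squared_le m by (simp add: field_simps power2_eq_square)
  finally show ?thesis by simp
qed

end

section \<open>The threshold scheme on independent trials\<close>

text \<open>Cauchy-Schwarz by expanding the integral of (f - c g)^2 at its minimiser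
  \<open>c\<close>.\<close>

lemma (in finite_measure) integral_mult_le_sqrt:
  fixes f g :: "'a \<Rightarrow> real"
  assumes f: "integrable M (\<lambda>x. f x ^ 2)" and g: "integrable M (\<lambda>x. g x ^ 2)"
    and fg: "integrable M (\<lambda>x. f x * g x)" and pos: "0 < (\<integral>x. g x ^ 2 \<partial>M)"
  shows "(\<integral>x. f x * g x \<partial>M) \<le> sqrt ((\<integral>x. f x ^ 2 \<partial>M) * (\<integral>x. g x ^ 2 \<partial>M))"
proof (rule real_le_rsqrt)
  let ?A = "\<integral>x. f x ^ 2 \<partial>M" and ?C = "\<integral>x. f x * g x \<partial>M" and ?D = "\<integral>x. g x ^ 2 \<partial>M"
  define c where "c = ?C / ?D"
  have "0 \<le> (\<integral>x. (f x - c * g x) ^ 2 \<partial>M)"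
    by simp
  also have "(\<lambda>x. (f x - c * g x) ^ 2) = (\<lambda>x. f x ^ 2 - 2 * c * (f x * g x) + c ^ 2 * g x ^ 2)"
    by (simp add: power2_eq_square algebra_simps)
  also have "(\<integral>x. f x ^ 2 - 2 * c * (f x * g x) + c ^ 2 * g x ^ 2 \<partial>M) = ?A - 2 * c * ?C + c ^ 2 * ?D"
    using f g fg by simp
  also have "\<dots> = ?A - ?C ^ 2 / ?D"
    using pos by (simp add: c_def field_simps power2_eq_square)
  finally show "?C ^ 2 \<le> ?A * ?D"
    using pos by (simp add: field_simps)
qed

text \<open>Collects the almost sure bounds on the trials, so that the crossing index can be studied
  path by path. The lower bound forces a crossing within \<open>t + 1\<close> trials; the upper
  bound limits the overshoot.\<close>

definition good_seq :: "nat \<Rightarrow> (nat \<Rightarrow> nat \<times> nat) \<Rightarrow> bool" where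
  "good_seq B \<omega> \<longleftrightarrow> (\<forall>i. 1 \<le> fst (\<omega> i) \<and> fst (\<omega> i) \<le> B \<and> snd (\<omega> i) \<le> fst (\<omega> i))"

text \<open>One functional serves for the crossing index (\<open>z\<close> constantly 1), the total
  size at crossing (\<open>z\<close> the first component) and the centred sum W.\<close>

definition thr_sum :: "(nat \<times> nat \<Rightarrow> real) \<Rightarrow> nat \<Rightarrow> (nat \<Rightarrow> nat \<times> nat) \<Rightarrow> real" where
  "thr_sum z t \<omega> = (\<Sum>j<thr_N \<omega> t. z (\<omega> j))"

definition overshoot :: "nat \<Rightarrow> (nat \<Rightarrow> nat \<times> nat) \<Rightarrow> real" where
  "overshoot t \<omega> = real (thr_T \<omega> (thr_N \<omega> t)) - real t"

lemma thr_T_case_nat: "thr_T (case_nat x \<omega>) (Suc n) = fst x + thr_T \<omega> n"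
  unfolding thr_T_def by (subst sum.lessThan_Suc_shift) simp

lemma thr_T_ge:
  assumes "good_seq B \<omega>"
  shows "n \<le> thr_T \<omega> n"
proof -
  have "(\<Sum>j<n. 1) \<le> thr_T \<omega> n"
    unfolding thr_T_def using assms by (intro sum_mono) (auto simp: good_seq_def)
  then show ?thesis by simp
qed

lemma thr_N_props:
  assumes "good_seq B \<omega>"
  shows "1 \<le> thr_N \<omega> t" "t < thr_T \<omega> (thr_N \<omega> t)"
proof -
  have "1 \<le> Suc t \<and> t < thr_T \<omega> (Suc t)"
    using thr_T_ge[OF assms, of "Suc t"] by simp
  from LeastI[of "\<lambda>i. 1 \<le> i \<and> t < thr_T \<omega> i", OF this]
  show "1 \<le> thr_N \<omega> t" "t < thr_T \<omega> (thr_N \<omega> t)"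
    by (simp_all add: thr_N_def)
qed

lemma overshoot_bounds:
  assumes "good_seq B \<omega>"
  shows "1 \<le> overshoot t \<omega>" "overshoot t \<omega> \<le> B"
proof -
  show "1 \<le> overshoot t \<omega>"
    using thr_N_props(2)[OF assms, of t] by (simp add: overshoot_def)
  obtain n where n: "thr_N \<omega> t = Suc n"
    using thr_N_props(1)[OF assms, of t] by (cases "thr_N \<omega> t") auto
  \<comment> \<open>Minimality says nothing about index 0, which \<open>1 \<le> i\<close> excludes
    from the minimum; there the empty sum gives the bound.\<close>
  have "thr_T \<omega> n \<le> t"
  proof (cases "n = 0")
    case False
    then show ?thesis
      using not_less_Least[of n "\<lambda>i. 1 \<le> i \<and> t < thr_T \<omega> i"] n by (simp add: thr_N_def)
  qed (simp add: thr_T_def)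
  moreover have "fst (\<omega> n) \<le> B"
    using assms by (simp add: good_seq_def)
  moreover have "thr_T \<omega> (Suc n) = thr_T \<omega> n + fst (\<omega> n)"
    by (simp add: thr_T_def)
  ultimately show "overshoot t \<omega> \<le> B"
    by (simp add: overshoot_def n)
qed

text \<open>Regeneration at the first trial. Crossing is strict, so a first trial of size exactly
  \<open>t\<close> does not stop the scheme and the tail starts with threshold 0.\<close>

lemma thr_N_case_nat:
  assumes "good_seq B \<omega>"
  shows "thr_N (case_nat x \<omega>) t = Suc (if t < fst x then 0 else thr_N \<omega> (t - fst x))"
proof (cases "t < fst x")
  case True
  then show ?thesis
    unfolding thr_N_def by (auto intro!: Least_equality simp: thr_T_case_nat)
next
  case False
  let ?P = "\<lambda>i. 1 \<le> i \<and> t < thr_T (case_nat x \<omega>) i"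
  \<comment> \<open>For \<open>n = 0\<close> both sides are false: index 1 is no crossing because
    \<open>fst x \<le> t\<close>.\<close>
  have eq: "?P (Suc n) \<longleftrightarrow> 1 \<le> n \<and> t - fst x < thr_T \<omega> n" for n
    using False by (cases n) (auto simp: thr_T_case_nat, simp add: thr_T_def)
  have "?P (Suc (thr_N \<omega> (t - fst x)))"
    unfolding eq using thr_N_props[OF assms] by blast
  then have "(LEAST i. ?P i) = Suc (LEAST n. ?P (Suc n))"
    by (rule Least_Suc) simp
  then show ?thesis
    using False unfolding eq by (simp add: thr_N_def)
qed

lemma thr_sum_case_nat:
  assumes "good_seq B \<omega>"
  shows "thr_sum z t (case_nat x \<omega>) = z x + (if t < fst x then 0 else thr_sum z (t - fst x) \<omega>)"
  unfolding thr_sum_def thr_N_case_nat[OF assms] sum.lessThan_Suc_shift by auto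

lemma overshoot_case_nat:
  assumes "good_seq B \<omega>"
  shows "overshoot t (case_nat x \<omega>) =
    (if t < fst x then real (fst x - t) else overshoot (t - fst x) \<omega>)"
  unfolding overshoot_def thr_N_case_nat[OF assms] thr_T_case_nat
  by (auto simp: of_nat_diff thr_T_def)

lemma thr_sum_fst: "thr_sum (\<lambda>x. real (fst x)) t \<omega> = real t + overshoot t \<omega>"
  by (simp add: thr_sum_def overshoot_def thr_T_def)

lemma thr_est_diff:
  assumes "good_seq B \<omega>"
  shows "thr_est \<omega> t - q = thr_sum (\<lambda>x. real (snd x) - q * real (fst x)) t \<omega> / (real t + overshoot t \<omega>)"
proof -
  have "real (thr_T \<omega> (thr_N \<omega> t)) > 0"
    using thr_N_props(2)[OF assms, of t] by simp
  moreover have "thr_sum (\<lambda>x. real (snd x) - q * real (fst x)) t \<omega>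
      = real (\<Sum>j<thr_N \<omega> t. snd (\<omega> j)) - q * real (thr_T \<omega> (thr_N \<omega> t))"
    by (simp add: thr_sum_def thr_T_def sum_subtractf sum_distrib_left)
  ultimately show ?thesis
    by (simp add: thr_est_def overshoot_def diff_divide_distrib)
qed

text \<open>With this bound a sum up to the crossing is at most the total size there, hence at most
  \<open>t + B\<close>, which yields integrability. The constant 1 qualifies because trials are
  nonempty.\<close>

definition dominated :: "(nat \<times> nat \<Rightarrow> real) \<Rightarrow> bool" where
  "dominated z \<longleftrightarrow> (\<forall>x. 1 \<le> fst x \<longrightarrow> snd x \<le> fst x \<longrightarrow> \<bar>z x\<bar> \<le> real (fst x))"

lemma abs_thr_sum_le:
  assumes "good_seq B \<omega>" and "dominated z"
  shows "\<bar>thr_sum z t \<omega>\<bar> \<le> real (t + B)"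
proof -
  have "\<bar>z (\<omega> j)\<bar> \<le> real (fst (\<omega> j))" for j
    using assms unfolding good_seq_def dominated_def by blast
  moreover have "\<bar>thr_sum z t \<omega>\<bar> \<le> (\<Sum>j<thr_N \<omega> t. \<bar>z (\<omega> j)\<bar>)"
    unfolding thr_sum_def by (rule sum_abs)
  ultimately have "\<bar>thr_sum z t \<omega>\<bar> \<le> thr_sum (\<lambda>x. real (fst x)) t \<omega>"
    unfolding thr_sum_def by (meson order_trans sum_mono)
  also have "\<dots> \<le> real (t + B)"
    using overshoot_bounds(2)[OF assms(1), of t] by (simp add: thr_sum_fst)
  finally show ?thesis .
qed

section \<open>Sequences of independent trials\<close>

locale iid_trials = prob_space L for L :: "(nat \<times> nat) measure" +
  fixes B :: nat
  assumes sets_L [simp, measurable_cong]: "sets L = sets (count_space UNIV)"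
    and AE_L: "AE x in L. 1 \<le> fst x \<and> fst x \<le> B \<and> snd x \<le> fst x"
begin

lemma space_L [simp]: "space L = UNIV"
  using sets_eq_imp_space_eq[OF sets_L] by simp

lemma measurable_L [simp, measurable]: "f \<in> L \<rightarrow>\<^sub>M N \<longleftrightarrow> f \<in> UNIV \<rightarrow> space N"
  unfolding measurable_cong_sets[OF sets_L refl] by (rule measurable_count_space_eq1)

lemma prob_space_L: "prob_space L"
  by unfold_locales

lemma measure_L_UNIV [simp]: "measure L UNIV = 1"
  using prob_space by simp

text \<open>The condition \<open>1 \<le> fst x\<close>, which holds almost surely, makes \<open>p 0\<close> vanish exactly.\<close>

definition p :: "nat \<Rightarrow> real" where
  "p k = measure L {x. 1 \<le> fst x \<and> fst x = k}"

lemma integrable_fst: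
  fixes g :: "nat \<Rightarrow> real"
  shows "integrable L (\<lambda>x. g (fst x))"
proof (rule integrable_const_bound)
  show "AE x in L. norm (g (fst x)) \<le> (\<Sum>k\<le>B. \<bar>g k\<bar>)"
    using AE_L by eventually_elim (auto intro!: member_le_sum)
qed simp

text \<open>Translates expectations of functions of M into the finite sums on which the renewal
  section works.\<close>

lemma integral_fst_eq:
  fixes g :: "nat \<Rightarrow> real"
  shows "(\<integral>x. g (fst x) \<partial>L) = (\<Sum>k\<le>B. p k * g k)"
proof -
  let ?A = "\<lambda>k. {x :: nat \<times> nat. 1 \<le> fst x \<and> fst x = k}"
  have "(\<integral>x. g (fst x) \<partial>L) = (\<integral>x. (\<Sum>k\<le>B. indicator (?A k) x * g k) \<partial>L)"
  proof (rule integral_cong_AE)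
    show "AE x in L. g (fst x) = (\<Sum>k\<le>B. indicator (?A k) x * g k)"
      using AE_L
    proof eventually_elim
      case (elim x)
      then have "(\<Sum>k\<le>B. indicator (?A k) x * g k) = (\<Sum>k\<le>B. if k = fst x then g k else 0)"
        by (intro sum.cong) (auto simp: indicator_def)
      with elim show ?case by simp
    qed
  qed auto
  also have "\<dots> = (\<Sum>k\<le>B. \<integral>x. indicator (?A k) x * g k \<partial>L)"
    by (rule Bochner_Integration.integral_sum) (auto intro!: integrable_real_indicator simp: less_top[symmetric])
  also have "\<dots> = (\<Sum>k\<le>B. p k * g k)"
    by (intro sum.cong) (auto simp: p_def)
  finally show ?thesis .
qed

lemma p_0: "p 0 = 0"
proof -
  have "{x :: nat \<times> nat. 1 \<le> fst x \<and> fst x = 0} = {}" by auto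
  then show ?thesis by (simp only: p_def measure_empty)
qed

lemma integrable_dominated:
  assumes "dominated z"
  shows "integrable L z"
proof (rule integrable_const_bound[where B = B])
  show "AE x in L. norm (z x) \<le> B"
    using AE_L
  proof eventually_elim
    case (elim x)
    with assms have "\<bar>z x\<bar> \<le> fst x"
      unfolding dominated_def by blast
    with elim show ?case by simp
  qed
qed simp

lemma integrable_dominated_square:
  assumes "dominated z"
  shows "integrable L (\<lambda>x. z x ^ 2)"
proof (rule integrable_const_bound[where B = "real B ^ 2"])
  show "AE x in L. norm (z x ^ 2) \<le> real B ^ 2"
    using AE_L
  proof eventually_elim
    case (elim x)
    with assms have "\<bar>z x\<bar> \<le> fst x"
      unfolding dominated_def by blast
    with elim have "\<bar>z x\<bar> \<le> \<bar>real B\<bar>" by simp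
    then show ?case by (simp only: abs_le_square_iff real_norm_def abs_power2)
  qed
qed simp

sublocale sequence_space L
  by unfold_locales

lemma coord_measurable [measurable]: "(\<lambda>\<omega>. g (\<omega> i)) \<in> S \<rightarrow>\<^sub>M count_space UNIV"
  by (rule measurable_compose[OF measurable_component_singleton]) auto

lemma coord_measurable_real [measurable]: "(\<lambda>\<omega>. g (\<omega> i) :: real) \<in> borel_measurable S"
  by (rule measurable_compose[OF measurable_component_singleton]) auto

lemma AE_good: "AE \<omega> in S. good_seq B \<omega>"
  unfolding good_seq_def
  by (subst AE_all_countable) (intro allI AE_PiM_component AE_L prob_space_L UNIV_I)

lemma thr_T_measurable [measurable]: "(\<lambda>\<omega>. thr_T \<omega> n) \<in> S \<rightarrow>\<^sub>M count_space UNIV"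
  unfolding thr_T_def by measurable

lemma thr_N_measurable [measurable]: "(\<lambda>\<omega>. thr_N \<omega> t) \<in> S \<rightarrow>\<^sub>M count_space UNIV"
  unfolding thr_N_def by measurable

lemma thr_sum_measurable [measurable]: "thr_sum z t \<in> borel_measurable S"
  unfolding thr_sum_def[abs_def]
  by (rule measurable_compose_countable[OF _ thr_N_measurable]) measurable

lemma overshoot_measurable [measurable]: "overshoot t \<in> borel_measurable S"
proof -
  have "overshoot t = (\<lambda>\<omega>. thr_sum (\<lambda>x. real (fst x)) t \<omega> - real t)"
    by (simp add: thr_sum_fst)
  then show ?thesis by simp
qed

lemma thr_est_measurable [measurable]: "(\<lambda>\<omega>. thr_est \<omega> t) \<in> borel_measurable S"
proof -
  have "(\<lambda>\<omega>. thr_est \<omega> t) =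
      (\<lambda>\<omega>. thr_sum (\<lambda>x. real (snd x)) t \<omega> / thr_sum (\<lambda>x. real (fst x)) t \<omega>)"
    by (simp add: thr_est_def thr_sum_def thr_T_def)
  then show ?thesis by simp
qed

lemma integrable_S:
  fixes F :: "_ \<Rightarrow> real"
  assumes "F \<in> borel_measurable S" and "\<And>\<omega>. good_seq B \<omega> \<Longrightarrow> \<bar>F \<omega>\<bar> \<le> c"
  shows "integrable S F"
  using AE_good assms by (intro P.integrable_const_bound[where B = c]) auto

text \<open>Prepending an independent trial leaves the law of the sequence unchanged, so Fubini
  gives conditioning on the first trial. The renewal equations for expectations over
  \<open>S\<close> all rest on this.\<close>

lemma integral_S_case_nat:
  fixes F :: "_ \<Rightarrow> real"
  assumes F: "integrable S F"
  shows "(\<integral>\<omega>. F \<omega> \<partial>S) = (\<integral>x. \<integral>\<omega>. F (case_nat x \<omega>) \<partial>S \<partial>L)"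
proof -
  interpret LS: pair_sigma_finite L S
    by unfold_locales
  let ?c = "\<lambda>(x, \<omega>). case_nat x \<omega> :: nat \<Rightarrow> nat \<times> nat"
  have c: "?c \<in> L \<Otimes>\<^sub>M S \<rightarrow>\<^sub>M S"
    by measurable
  have "(\<integral>\<omega>. F \<omega> \<partial>S) = (\<integral>\<omega>. F \<omega> \<partial>distr (L \<Otimes>\<^sub>M S) S ?c)"
    by (simp add: PiM_iter)
  also have "\<dots> = (\<integral>y. F (?c y) \<partial>(L \<Otimes>\<^sub>M S))"
    using F by (intro integral_distr[OF c]) simp
  also have "\<dots> = (\<integral>x. \<integral>\<omega>. F (case_nat x \<omega>) \<partial>S \<partial>L)"
  proof -
    have "integrable (L \<Otimes>\<^sub>M S) (\<lambda>y. F (?c y))"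
      using F integrable_distr_eq[OF c, of F] by (simp add: PiM_iter)
    from LS.integral_fst'[OF this] show ?thesis by simp
  qed
  finally show ?thesis .
qed

section \<open>Renewal equations for sums up to the crossing\<close>

definition Es :: "(nat \<times> nat \<Rightarrow> real) \<Rightarrow> nat \<Rightarrow> real" where
  "Es z t = (\<integral>\<omega>. thr_sum z t \<omega> \<partial>S)"

lemma integrable_thr_sum: "dominated z \<Longrightarrow> integrable S (thr_sum z t)"
  by (rule integrable_S) (auto intro: abs_thr_sum_le)

lemma integrable_thr_sum_square: "dominated z \<Longrightarrow> integrable S (\<lambda>\<omega>. thr_sum z t \<omega> ^ 2)"
proof (rule integrable_S)
  fix \<omega> assume "dominated z" "good_seq B \<omega>"
  then have "\<bar>thr_sum z t \<omega>\<bar> \<le> \<bar>real (t + B)\<bar>"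
    using abs_thr_sum_le by fastforce
  then show "\<bar>thr_sum z t \<omega> ^ 2\<bar> \<le> real (t + B) ^ 2"
    by (simp only: abs_le_square_iff abs_power2)
qed simp

lemma Es_renewal:
  assumes z: "dominated z"
  shows "Es z t = (\<integral>x. z x \<partial>L) + (\<Sum>k\<le>B. p k * (if k \<le> t then Es z (t - k) else 0))"
proof -
  have "Es z t = (\<integral>x. \<integral>\<omega>. thr_sum z t (case_nat x \<omega>) \<partial>S \<partial>L)"
    unfolding Es_def by (rule integral_S_case_nat) (rule integrable_thr_sum[OF z])
  also have "\<dots> = (\<integral>x. \<integral>\<omega>. z x + (if fst x \<le> t then thr_sum z (t - fst x) \<omega> else 0) \<partial>S \<partial>L)"
    by (intro Bochner_Integration.integral_cong refl integral_cong_AE)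
      (use AE_good in \<open>auto elim!: eventually_mono simp: thr_sum_case_nat\<close>)
  also have "\<dots> = (\<integral>x. z x + (if fst x \<le> t then Es z (t - fst x) else 0) \<partial>L)"
    by (intro Bochner_Integration.integral_cong refl)
      (auto simp: Es_def integrable_thr_sum[OF z] P.prob_space)
  also have "\<dots> = (\<integral>x. z x \<partial>L) + (\<Sum>k\<le>B. p k * (if k \<le> t then Es z (t - k) else 0))"
    using integrable_fst[of "\<lambda>k. if k \<le> t then Es z (t - k) else 0"]
      integral_fst_eq[of "\<lambda>k. if k \<le> t then Es z (t - k) else 0"] integrable_dominated[OF z] by simp
  finally show ?thesis .
qed

lemma dominated_1: "dominated (\<lambda>_. 1)"
  by (simp add: dominated_def)

text \<open>The abstract renewal function becomes E[N(t)], since constant summands 1 count the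
  trials.\<close>

sublocale discrete_renewal p B "Es (\<lambda>_. 1)"
proof
  show "0 \<le> p k" for k by (simp add: p_def)
  show "p 0 = 0" by (rule p_0)
  show "(\<Sum>k\<le>B. p k) = 1"
    using integral_fst_eq[of "\<lambda>_. 1"] by simp
  show "Es (\<lambda>_. 1) t = 1 + (\<Sum>k\<le>B. p k * (if k \<le> t then Es (\<lambda>_. 1) (t - k) else 0))" for t
    using Es_renewal[OF dominated_1, of t] by simp
qed

abbreviation "U \<equiv> Es (\<lambda>_. 1)"

lemma mom_eq: "mom n = (\<integral>x. real (fst x) ^ n \<partial>L)"
  unfolding mom_def by (rule integral_fst_eq[symmetric])

text \<open>Conditioning on the first trial turns both Wald identities into renewal equations.\<close>

lemma Wald:
  assumes z: "dominated z"
  shows "Es z t = (\<integral>x. z x \<partial>L) * U t"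
proof (rule renewal_unique)
  show "Es z t = (\<integral>x. z x \<partial>L) + conv (Es z) t" for t
    using Es_renewal[OF z] by (simp add: conv_def)
  show "(\<integral>x. z x \<partial>L) * U t = (\<integral>x. z x \<partial>L) + conv (\<lambda>t. (\<integral>x. z x \<partial>L) * U t) t" for t
    unfolding conv_cmult by (subst U_eq) (simp add: algebra_simps)
qed

lemma Wald_second:
  assumes z: "dominated z" and z0: "(\<integral>x. z x \<partial>L) = 0"
  shows "(\<integral>\<omega>. thr_sum z t \<omega> ^ 2 \<partial>S) = (\<integral>x. z x ^ 2 \<partial>L) * U t"
proof (rule renewal_unique)
  let ?E = "\<lambda>t. \<integral>\<omega>. thr_sum z t \<omega> ^ 2 \<partial>S"
  fix t
  have "?E t = (\<integral>x. \<integral>\<omega>. thr_sum z t (case_nat x \<omega>) ^ 2 \<partial>S \<partial>L)"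
    by (rule integral_S_case_nat) (rule integrable_thr_sum_square[OF z])
  also have "\<dots> = (\<integral>x. \<integral>\<omega>. z x ^ 2 + (if fst x \<le> t then
      2 * z x * thr_sum z (t - fst x) \<omega> + thr_sum z (t - fst x) \<omega> ^ 2 else 0) \<partial>S \<partial>L)"
    by (intro Bochner_Integration.integral_cong refl integral_cong_AE)
      (use AE_good in \<open>auto elim!: eventually_mono simp: thr_sum_case_nat power2_sum\<close>)
  \<comment> \<open>The cross term vanishes: by the first Wald identity the tail sum has mean zero
    at every threshold.\<close>
  also have "\<dots> = (\<integral>x. z x ^ 2 + (if fst x \<le> t then ?E (t - fst x) else 0) \<partial>L)"
    using Wald[OF z] z0
    by (intro Bochner_Integration.integral_cong refl)
      (auto simp: Es_def integrable_thr_sum[OF z] integrable_thr_sum_square[OF z] P.prob_space)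
  also have "\<dots> = (\<integral>x. z x ^ 2 \<partial>L) + conv ?E t"
    using integrable_fst[of "\<lambda>k. if k \<le> t then ?E (t - k) else 0"]
      integral_fst_eq[of "\<lambda>k. if k \<le> t then ?E (t - k) else 0"] integrable_dominated_square[OF z]
    by (simp add: conv_def)
  finally show "?E t = (\<integral>x. z x ^ 2 \<partial>L) + conv ?E t" .
  show "(\<integral>x. z x ^ 2 \<partial>L) * U t = (\<integral>x. z x ^ 2 \<partial>L) + conv (\<lambda>t. (\<integral>x. z x ^ 2 \<partial>L) * U t) t"
    unfolding conv_cmult by (subst U_eq) (simp add: algebra_simps)
qed

lemma integrable_overshoot_square: "integrable S (\<lambda>\<omega>. overshoot t \<omega> ^ 2)"
proof (rule integrable_S)
  fix \<omega> assume "good_seq B \<omega>"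
  then show "\<bar>overshoot t \<omega> ^ 2\<bar> \<le> real B ^ 2"
    using overshoot_bounds[of B \<omega> t] by (simp add: power_mono)
qed simp

text \<open>Discharges the hypothesis on \<open>h\<close> in the overshoot lemmas. The truncated
  \<open>fst x - t\<close> vanishes unless the first trial crosses, so the two cases simply
  add.\<close>

lemma overshoot_square_renewal:
  defines "h \<equiv> \<lambda>t. \<integral>\<omega>. overshoot t \<omega> ^ 2 \<partial>S"
  shows "h t = (\<Sum>k\<le>B. p k * real (k - t) ^ 2) + conv h t"
proof -
  have "h t = (\<integral>x. \<integral>\<omega>. overshoot t (case_nat x \<omega>) ^ 2 \<partial>S \<partial>L)"
    unfolding h_def by (rule integral_S_case_nat) (rule integrable_overshoot_square)
  also have "\<dots> = (\<integral>x. \<integral>\<omega>. real (fst x - t) ^ 2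
      + (if fst x \<le> t then overshoot (t - fst x) \<omega> ^ 2 else 0) \<partial>S \<partial>L)"
    by (intro Bochner_Integration.integral_cong refl integral_cong_AE)
      (use AE_good in \<open>auto elim!: eventually_mono simp: overshoot_case_nat\<close>)
  also have "\<dots> = (\<integral>x. real (fst x - t) ^ 2 + (if fst x \<le> t then h (t - fst x) else 0) \<partial>L)"
    by (intro Bochner_Integration.integral_cong refl)
      (auto simp: h_def integrable_overshoot_square P.prob_space)
  also have "\<dots> = (\<Sum>k\<le>B. p k * (real (k - t) ^ 2 + (if k \<le> t then h (t - k) else 0)))"
    by (rule integral_fst_eq)
  finally show ?thesis
    by (simp add: conv_def distrib_left sum.distrib)
qed

text \<open>Lorden's first-moment bound, solved for the expected number of trials.\<close>

lemma U_le: "U t \<le> (t + mom 2 / mom 1) / mom 1"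
  using excess_le[OF overshoot_square_renewal, of t] mom_1_ge
  by (simp add: excess_def field_simps)

section \<open>Error bounds for one set of target probability q\<close>

context
  fixes q :: real and t :: nat
  assumes q: "0 \<le> q" "q \<le> 1" and t: "1 \<le> t"
    and unbiased: "(\<integral>x. real (snd x) \<partial>L) = q * (\<integral>x. real (fst x) \<partial>L)"
begin

private abbreviation "z \<equiv> \<lambda>x. real (snd x) - q * real (fst x)"
private abbreviation "W \<equiv> thr_sum z t"

private lemma dominated_z: "dominated z"
  unfolding dominated_def
proof (intro allI impI)
  fix x :: "nat \<times> nat" assume "1 \<le> fst x" "snd x \<le> fst x"
  then show "\<bar>z x\<bar> \<le> real (fst x)"
    using q mult_left_le_one_le[of "real (fst x)" q] mult_nonneg_nonneg[of q "real (fst x)"] by linarith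
qed

private lemma integral_z: "(\<integral>x. z x \<partial>L) = 0"
proof -
  have "integrable L (\<lambda>x. real (snd x))"
    by (rule integrable_dominated) (simp add: dominated_def)
  then show ?thesis
    using integrable_fst[of real] unbiased by simp
qed

text \<open>From H and q M both lying in [0, M] follows |z| \<le> M. The resulting bound involves M
  alone, which is what later makes the estimates uniform in A.\<close>

private lemma W_square_le: "(\<integral>\<omega>. W \<omega> ^ 2 \<partial>S) \<le> mom 2 * U t"
proof -
  have "(\<integral>x. z x ^ 2 \<partial>L) \<le> mom 2"
    unfolding mom_eq
  proof (rule integral_mono_AE)
    show "AE x in L. z x ^ 2 \<le> real (fst x) ^ 2"
      using AE_L
    proof eventually_elim
      case (elim x)
      then have "\<bar>z x\<bar> \<le> \<bar>real (fst x)\<bar>"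
        using dominated_z unfolding dominated_def by simp
      then show ?case by (simp only: abs_le_square_iff)
    qed
  qed (use integrable_dominated_square[OF dominated_z] integrable_fst[of "\<lambda>k. real k ^ 2"] in auto)
  then show ?thesis
    using Wald_second[OF dominated_z integral_z, of t] U_nonneg[of t] by (simp add: mult_right_mono)
qed

private lemma AE_est: "AE \<omega> in S. thr_est \<omega> t - q = W \<omega> / (real t + overshoot t \<omega>)"
  using AE_good by eventually_elim (rule thr_est_diff)

private lemma integrable_est: "integrable S (\<lambda>\<omega>. thr_est \<omega> t)"
proof (rule integrable_S)
  fix \<omega> assume good: "good_seq B \<omega>"
  have "real (\<Sum>j<thr_N \<omega> t. snd (\<omega> j)) \<le> real (thr_T \<omega> (thr_N \<omega> t))"
    unfolding thr_T_def of_nat_le_iff using good by (intro sum_mono) (auto simp: good_seq_def)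
  then have "thr_est \<omega> t \<le> 1"
    unfolding thr_est_def by (intro divide_le_eq_1[THEN iffD2]) auto
  moreover have "0 \<le> thr_est \<omega> t"
    unfolding thr_est_def by (intro divide_nonneg_nonneg of_nat_0_le_iff)
  ultimately show "\<bar>thr_est \<omega> t\<bar> \<le> 1" by simp
qed simp

lemma mean_abs_error:
  "(\<integral>\<omega>. \<bar>thr_est \<omega> t - q\<bar> \<partial>S) \<le> sqrt (mom 2 * U t) / t"
proof -
  have W: "integrable S (\<lambda>\<omega>. \<bar>W \<omega>\<bar>)"
    using integrable_thr_sum[OF dominated_z] by simp
  have "(\<integral>\<omega>. \<bar>thr_est \<omega> t - q\<bar> \<partial>S) \<le> (\<integral>\<omega>. \<bar>W \<omega>\<bar> / t \<partial>S)"
  proof (rule integral_mono_AE)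
    show "AE \<omega> in S. \<bar>thr_est \<omega> t - q\<bar> \<le> \<bar>W \<omega>\<bar> / t"
      using AE_est AE_good
    proof eventually_elim
      case (elim \<omega>)
      then show ?case
        using overshoot_bounds(1)[of B \<omega> t] t by (auto simp: abs_divide intro!: divide_left_mono)
    qed
  qed (use integrable_est W in auto)
  also have "\<dots> = (\<integral>\<omega>. \<bar>W \<omega>\<bar> * 1 \<partial>S) / t"
    by simp
  also have "\<dots> \<le> sqrt ((\<integral>\<omega>. \<bar>W \<omega>\<bar> ^ 2 \<partial>S) * (\<integral>\<omega>. 1 ^ 2 \<partial>S)) / t"
    by (intro divide_right_mono P.integral_mult_le_sqrt)
      (use W integrable_thr_sum_square[OF dominated_z] in \<open>auto simp: P.prob_space\<close>)
  also have "\<dots> \<le> sqrt (mom 2 * U t) / t"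
    using W_square_le by (intro divide_right_mono real_sqrt_le_mono) (auto simp: P.prob_space)
  finally show ?thesis .
qed

lemma bias:
  "\<bar>(\<integral>\<omega>. thr_est \<omega> t \<partial>S) - q\<bar> \<le> sqrt (mom 2 * U t * (4 / 3 * mom 3 / mom 1)) / t ^ 2"
proof -
  have W: "integrable S W"
    by (rule integrable_thr_sum[OF dominated_z])
  have WR: "integrable S (\<lambda>\<omega>. \<bar>W \<omega>\<bar> * overshoot t \<omega>)"
  proof (rule integrable_S)
    fix \<omega> assume "good_seq B \<omega>"
    then show "\<bar>\<bar>W \<omega>\<bar> * overshoot t \<omega>\<bar> \<le> real (t + B) * real B"
      using abs_thr_sum_le[OF _ dominated_z, of B \<omega> t] overshoot_bounds[of B \<omega> t]
      by (auto simp: abs_mult intro!: mult_mono)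
  qed simp
  \<comment> \<open>Supplies the positivity required by the Cauchy-Schwarz lemma.\<close>
  have R: "1 \<le> (\<integral>\<omega>. overshoot t \<omega> ^ 2 \<partial>S)"
  proof (rule P.integral_ge_const)
    show "AE \<omega> in S. 1 \<le> overshoot t \<omega> ^ 2"
      using AE_good by eventually_elim (simp add: overshoot_bounds)
  qed (rule integrable_overshoot_square)
  have EW: "(\<integral>\<omega>. W \<omega> \<partial>S) = 0"
    using Wald[OF dominated_z, of t] integral_z by (simp add: Es_def)
  have "(\<integral>\<omega>. thr_est \<omega> t \<partial>S) - q = (\<integral>\<omega>. thr_est \<omega> t - q - W \<omega> / t \<partial>S)"
    using integrable_est W EW by (simp add: P.prob_space)
  also have "\<bar>\<dots>\<bar> \<le> (\<integral>\<omega>. \<bar>thr_est \<omega> t - q - W \<omega> / t\<bar> \<partial>S)"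
    by (rule integral_abs_bound)
  also have "\<dots> \<le> (\<integral>\<omega>. \<bar>W \<omega>\<bar> * overshoot t \<omega> / t ^ 2 \<partial>S)"
  proof (rule integral_mono_AE)
    show "AE \<omega> in S. \<bar>thr_est \<omega> t - q - W \<omega> / t\<bar> \<le> \<bar>W \<omega>\<bar> * overshoot t \<omega> / t ^ 2"
      using AE_est AE_good
    proof eventually_elim
      case (elim \<omega>)
      let ?R = "overshoot t \<omega>"
      have R: "1 \<le> ?R" using overshoot_bounds(1)[OF elim(2)] .
      \<comment> \<open>The difference of 1/(t + R) and 1/t is -R/(t (t + R)).\<close>
      have "thr_est \<omega> t - q - W \<omega> / t = - (W \<omega> * ?R / (t * (t + ?R)))"
        unfolding elim(1) using R t by (simp add: field_simps)
      then have "\<bar>thr_est \<omega> t - q - W \<omega> / t\<bar> = \<bar>W \<omega>\<bar> * ?R / (t * (t + ?R))"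
        using R t by (simp add: abs_mult abs_divide)
      also have "\<dots> \<le> \<bar>W \<omega>\<bar> * ?R / t ^ 2"
        using R t by (intro divide_left_mono) (auto simp: power2_eq_square)
      finally show ?case .
    qed
  qed (use integrable_est W WR in auto)
  also have "\<dots> = (\<integral>\<omega>. \<bar>W \<omega>\<bar> * overshoot t \<omega> \<partial>S) / t ^ 2"
    by simp
  also have "\<dots> \<le> sqrt ((\<integral>\<omega>. \<bar>W \<omega>\<bar> ^ 2 \<partial>S) * (\<integral>\<omega>. overshoot t \<omega> ^ 2 \<partial>S)) / t ^ 2"
    by (intro divide_right_mono P.integral_mult_le_sqrt WR integrable_overshoot_square)
      (use R integrable_thr_sum_square[OF dominated_z] in auto)
  also have "\<dots> \<le> sqrt (mom 2 * U t * (4 / 3 * mom 3 / mom 1)) / t ^ 2"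
    using W_square_le second_moment_le[OF overshoot_square_renewal, of t] R
      mult_nonneg_nonneg[OF mom_nonneg U_nonneg, of 2 t]
    by (intro divide_right_mono real_sqrt_le_mono mult_mono) auto
  finally show ?thesis .
qed

lemma bias_bound:
  "\<bar>(\<integral>\<omega>. thr_est \<omega> t \<partial>S) - q\<bar>
    \<le> sqrt (4/3 * mom 3 * mom 2 * (mom 1 + mom 2 / real t)) / mom 1 ^ 3
        * (real t / mom 1) powr (-3/2)"
proof -
  let ?m = "mom 1"
  have m: "?m > 0" using mom_1_ge by simp
  have t0: "real t > 0" using t by simp
  \<comment> \<open>Used with \<open>d = mom 1 ^ 3\<close> to separate the constant from the power
    of \<open>t / mom 1\<close>.\<close>
  have aux: "a * b / c = a / d * (b * d / c)" if "d \<noteq> 0" for a b c d :: real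
    using that by simp
  let ?X = "4/3 * mom 3 * mom 2 * (?m + mom 2 / real t)"
  have "mom 2 * U t * (4 / 3 * mom 3 / ?m) \<le> mom 2 * ((t + mom 2 / ?m) / ?m) * (4 / 3 * mom 3 / ?m)"
    using U_le[of t] m mom_nonneg by (intro mult_right_mono mult_left_mono) auto
  also have "\<dots> = ?X * (t / ?m ^ 3)"
    using m t0 by (simp add: field_simps power3_eq_cube)
  finally have "sqrt (mom 2 * U t * (4 / 3 * mom 3 / ?m)) / t ^ 2 \<le> sqrt (?X * (t / ?m ^ 3)) / t ^ 2"
    by (intro divide_right_mono real_sqrt_le_mono) auto
  also have "\<dots> = sqrt ?X / ?m ^ 3 * (sqrt (t / ?m ^ 3) * ?m ^ 3 / t ^ 2)"
    unfolding real_sqrt_mult[of ?X] using m by (intro aux) simp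
  also have "sqrt (t / ?m ^ 3) * ?m ^ 3 / t ^ 2 = (t / ?m) powr (-3/2)"
  proof -
    have "sqrt (t / ?m ^ 3) = (t / ?m) powr (1/2) / ?m"
    proof -
      have "t / ?m ^ 3 = (t / ?m) / ?m ^ 2"
        by (simp add: power2_eq_square power3_eq_cube)
      then show ?thesis
        using m t0 by (simp add: powr_half_sqrt real_sqrt_divide real_sqrt_mult)
    qed
    then have "sqrt (t / ?m ^ 3) * ?m ^ 3 / t ^ 2 = (t / ?m) powr (1/2) / (t / ?m) ^ 2"
      using m t0 by (simp add: field_simps power2_eq_square power3_eq_cube)
    also have "\<dots> = (t / ?m) powr (1/2 - 2)"
      using m t0 by (subst powr_diff) simp
    finally show ?thesis by simp
  qed
  finally show ?thesis using bias by linarith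
qed

lemma mean_abs_error_bound:
  "(\<integral>\<omega>. \<bar>thr_est \<omega> t - q\<bar> \<partial>S)
    \<le> (sqrt (mom 2) / mom 1 + mom 2 / (mom 1 powr (3/2) * sqrt (real t)))
        * (real t / mom 1) powr (-1/2)"
proof -
  let ?m = "mom 1"
  have m: "?m > 0" using mom_1_ge by simp
  have t0: "real t > 0" using t by simp
  have "mom 2 * U t \<le> mom 2 * ((t + mom 2 / ?m) / ?m)"
    using U_le[of t] mom_nonneg by (intro mult_left_mono) auto
  also have "\<dots> = mom 2 * t / ?m + (mom 2 / ?m) ^ 2"
    using m by (simp add: field_simps power2_eq_square)
  finally have "sqrt (mom 2 * U t) / t \<le> sqrt (mom 2 * t / ?m + (mom 2 / ?m) ^ 2) / t"
    by (intro divide_right_mono real_sqrt_le_mono) auto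
  \<comment> \<open>Splitting the root produces the two summands of the second constant.\<close>
  also have "\<dots> \<le> (sqrt (mom 2 * t / ?m) + sqrt ((mom 2 / ?m) ^ 2)) / t"
    using m mom_nonneg by (intro divide_right_mono sqrt_add_le_add_sqrt) auto
  also have "\<dots> = (sqrt (mom 2) * sqrt t / sqrt ?m + mom 2 / ?m) / t"
    using m mom_nonneg[of 2] by (simp add: real_sqrt_mult real_sqrt_divide)
  also have "\<dots> = (sqrt (mom 2) / ?m + mom 2 / (?m powr (3/2) * sqrt (real t)))
        * (real t / ?m) powr (-1/2)"
  proof -
    have p1: "(real t / ?m) powr (-1/2) = sqrt ?m / sqrt t"
      using m t0 by (simp add: powr_minus_divide powr_half_sqrt real_sqrt_divide)
    have "?m powr (3/2) = ?m powr (1 + 1/2)" by simp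
    also have "\<dots> = ?m * sqrt ?m"
      using m by (simp only: powr_add powr_half_sqrt powr_one)
    finally have p2: "?m powr (3/2) = ?m * sqrt ?m" .
    define a b where "a = sqrt ?m" and "b = sqrt (real t)"
    have ab: "a > 0" "b > 0" "?m = a * a" "real t = b * b"
      using m t0 by (auto simp: a_def b_def)
    show ?thesis
      unfolding p1 p2 unfolding a_def[symmetric] b_def[symmetric] unfolding ab(3,4)
      using ab(1,2) by (simp add: field_simps)
  qed
  finally show ?thesis using mean_abs_error by linarith
qed

end
end

section \<open>The law of a splitting trial\<close>

lemma sets_cnt [simp, measurable_cong]: "sets cnt = sets (count_space UNIV)"
  by (simp add: cnt_def)

lemma space_cnt [simp]: "space cnt = UNIV"
  by (simp add: cnt_def)

lemma measurable_cnt [simp, measurable]: "f \<in> cnt \<rightarrow>\<^sub>M N \<longleftrightarrow> f \<in> UNIV \<rightarrow> space N"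
  unfolding cnt_def by (rule measurable_count_space_eq1)

text \<open>The convolution of two laws of counts, i.e. the law of an independent sum, singled out
  of the recursion for \<open>gs_chain\<close>.\<close>

definition cnt_conv :: "(nat \<times> nat) measure \<Rightarrow> (nat \<times> nat) measure \<Rightarrow> (nat \<times> nat) measure" where
  "cnt_conv D E = D \<bind> (\<lambda>c. E \<bind> (\<lambda>c'. return cnt (fst c + fst c', snd c + snd c')))"

lemma gs_chain_Suc:
  "gs_chain k P sub (Suc n) x =
    k x \<bind> (\<lambda>y. cnt_conv (if P y then sub y else return cnt (0, 0)) (gs_chain k P sub n y))"
  by (simp add: cnt_conv_def)

lemma cnt_conv_measurable [measurable (raw)]:
  assumes D: "D \<in> M \<rightarrow>\<^sub>M prob_algebra cnt" and E: "E \<in> M \<rightarrow>\<^sub>M prob_algebra cnt"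
  shows "(\<lambda>y. cnt_conv (D y) (E y)) \<in> M \<rightarrow>\<^sub>M prob_algebra cnt"
proof -
  let ?add = "\<lambda>(c, c'). (fst c + fst c', snd c + snd c') :: nat \<times> nat"
  \<comment> \<open>Both factors are countable and discrete, hence so is the product, and every map
    on it is measurable.\<close>
  have add: "?add \<in> cnt \<Otimes>\<^sub>M cnt \<rightarrow>\<^sub>M cnt"
    unfolding cnt_def by (simp add: pair_measure_countable)
  have "(\<lambda>x. return cnt (?add (snd (fst x), snd x))) \<in> (M \<Otimes>\<^sub>M cnt) \<Otimes>\<^sub>M cnt \<rightarrow>\<^sub>M prob_algebra cnt"
    by (rule measurable_compose[OF measurable_compose[OF _ add] measurable_return_prob_space]) measurable
  then have ret: "(\<lambda>(yc, c'). return cnt (fst (snd yc) + fst c', snd (snd yc) + snd c'))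
      \<in> (M \<Otimes>\<^sub>M cnt) \<Otimes>\<^sub>M cnt \<rightarrow>\<^sub>M prob_algebra cnt"
    by (simp add: case_prod_beta)
  have "(\<lambda>yc. E (fst yc)) \<in> M \<Otimes>\<^sub>M cnt \<rightarrow>\<^sub>M prob_algebra cnt"
    by (rule measurable_compose[OF measurable_fst E])
  from measurable_bind_prob_space2[OF this ret] show ?thesis
    unfolding cnt_conv_def
    by (intro measurable_bind_prob_space2[OF D]) (simp add: case_prod_beta)
qed

lemma kernel_at:
  assumes "k \<in> borel \<rightarrow>\<^sub>M prob_algebra N"
  shows "k x \<in> space (prob_algebra N)"
  using measurable_space[OF assms, of x] by simp

lemma
  assumes D: "D \<in> space (prob_algebra cnt)" and E: "E \<in> space (prob_algebra cnt)"
  shows nn_integral_cnt_conv: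
      "(\<integral>\<^sup>+c. h c \<partial>cnt_conv D E) = (\<integral>\<^sup>+c. \<integral>\<^sup>+c'. h (fst c + fst c', snd c + snd c') \<partial>E \<partial>D)"
    and AE_cnt_conv:
      "(AE c in cnt_conv D E. Q c) \<longleftrightarrow> (AE c in D. AE c' in E. Q (fst c + fst c', snd c + snd c'))"
proof -
  have sets_DE: "sets D = sets cnt" "sets E = sets cnt" and E': "subprob_space E"
    using D E by (auto simp: space_prob_algebra prob_space_imp_subprob_space)
  have space_E: "space E = UNIV"
    using sets_eq_imp_space_eq[OF sets_DE(2)] by simp
  have ret: "(\<lambda>c'. return cnt (fst c + fst c', snd c + snd c')) \<in> E \<rightarrow>\<^sub>M subprob_algebra cnt" for c
    unfolding measurable_cong_sets[OF sets_DE(2) refl]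
    by (simp add: space_subprob_algebra prob_space_imp_subprob_space prob_space_return)
  have inner: "(\<lambda>c. E \<bind> (\<lambda>c'. return cnt (fst c + fst c', snd c + snd c'))) \<in> D \<rightarrow>\<^sub>M subprob_algebra cnt"
    unfolding measurable_cong_sets[OF sets_DE(1) refl] measurable_cnt
  proof
    fix c :: "nat \<times> nat"
    show "E \<bind> (\<lambda>c'. return cnt (fst c + fst c', snd c + snd c')) \<in> space (subprob_algebra cnt)"
      using subprob_space_bind[OF E' ret] sets_bind[of E _ cnt] space_E
      by (simp add: space_subprob_algebra)
  qed
  have "(\<integral>\<^sup>+c. h c \<partial>cnt_conv D E)
      = (\<integral>\<^sup>+c. \<integral>\<^sup>+c''. h c'' \<partial>(E \<bind> (\<lambda>c'. return cnt (fst c + fst c', snd c + snd c'))) \<partial>D)"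
    unfolding cnt_conv_def by (rule nn_integral_bind[OF _ inner]) simp
  also have "\<dots> = (\<integral>\<^sup>+c. \<integral>\<^sup>+c'. h (fst c + fst c', snd c + snd c') \<partial>E \<partial>D)"
    by (intro nn_integral_cong, subst nn_integral_bind[OF _ ret]) (simp_all add: nn_integral_return)
  finally show "(\<integral>\<^sup>+c. h c \<partial>cnt_conv D E)
      = (\<integral>\<^sup>+c. \<integral>\<^sup>+c'. h (fst c + fst c', snd c + snd c') \<partial>E \<partial>D)" .
  show "(AE c in cnt_conv D E. Q c) \<longleftrightarrow> (AE c in D. AE c' in E. Q (fst c + fst c', snd c + snd c'))"
    unfolding cnt_conv_def by (subst AE_bind[OF inner], simp, subst AE_bind[OF ret]) (simp_all add: AE_return)
qed

lemma return_cnt_in_prob_algebra: "return cnt c \<in> space (prob_algebra cnt)"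
  by (simp add: space_prob_algebra prob_space_return)

lemma gs_step_measurable:
  assumes "Measurable.pred borel P"
    and "sub \<in> borel \<rightarrow>\<^sub>M prob_algebra cnt" and "E \<in> borel \<rightarrow>\<^sub>M prob_algebra cnt"
  shows "(\<lambda>y. cnt_conv (if P y then sub y else return cnt (0, 0)) (E y)) \<in> borel \<rightarrow>\<^sub>M prob_algebra cnt"
proof -
  note [measurable] = assms
  have [measurable]: "(\<lambda>y. return cnt (0, 0)) \<in> borel \<rightarrow>\<^sub>M prob_algebra cnt"
    by (simp add: return_cnt_in_prob_algebra)
  show ?thesis by measurable
qed

lemma gs_chain_measurable:
  assumes k: "k \<in> borel \<rightarrow>\<^sub>M prob_algebra borel" and P: "Measurable.pred borel P"
    and sub: "sub \<in> borel \<rightarrow>\<^sub>M prob_algebra cnt"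
  shows "gs_chain k P sub n \<in> borel \<rightarrow>\<^sub>M prob_algebra cnt"
proof (induction n)
  case 0
  have "gs_chain k P sub 0 = (\<lambda>x. return cnt (0, 0))" by auto
  then show ?case by (simp add: return_cnt_in_prob_algebra)
next
  case (Suc n)
  have "gs_chain k P sub (Suc n) =
      (\<lambda>x. k x \<bind> (\<lambda>y. cnt_conv (if P y then sub y else return cnt (0, 0)) (gs_chain k P sub n y)))"
    by (rule ext) (rule gs_chain_Suc)
  then show ?case
    using measurable_bind_prob_space[OF k gs_step_measurable[OF P sub Suc]] by simp
qed

lemma
  assumes k: "k \<in> borel \<rightarrow>\<^sub>M prob_algebra borel" and P: "Measurable.pred borel P"
    and sub: "sub \<in> borel \<rightarrow>\<^sub>M prob_algebra cnt"
  shows nn_integral_gs_chain_Suc: "(\<integral>\<^sup>+c. h c \<partial>gs_chain k P sub (Suc n) x) =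
      (\<integral>\<^sup>+y. \<integral>\<^sup>+c. \<integral>\<^sup>+c'. h (fst c + fst c', snd c + snd c') \<partial>gs_chain k P sub n y
        \<partial>(if P y then sub y else return cnt (0, 0)) \<partial>k x)"
    and AE_gs_chain_Suc: "(AE c in gs_chain k P sub (Suc n) x. Q c) \<longleftrightarrow>
      (AE y in k x. AE c in (if P y then sub y else return cnt (0, 0)).
        AE c' in gs_chain k P sub n y. Q (fst c + fst c', snd c + snd c'))"
proof -
  let ?sub = "\<lambda>y. if P y then sub y else return cnt (0, 0)"
  note chain = gs_chain_measurable[OF k P sub, of n]
  have sets_k: "sets (k x) = sets borel"
    using kernel_at[OF k, of x] by (simp add: space_prob_algebra)
  have step: "(\<lambda>y. cnt_conv (?sub y) (gs_chain k P sub n y)) \<in> k x \<rightarrow>\<^sub>M subprob_algebra cnt"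
    unfolding measurable_cong_sets[OF sets_k refl]
    by (rule measurable_prob_algebraD[OF gs_step_measurable[OF P sub chain]])
  have mem: "?sub y \<in> space (prob_algebra cnt)" "gs_chain k P sub n y \<in> space (prob_algebra cnt)" for y
    using kernel_at[OF sub] kernel_at[OF chain] return_cnt_in_prob_algebra by simp_all
  show "(\<integral>\<^sup>+c. h c \<partial>gs_chain k P sub (Suc n) x) =
      (\<integral>\<^sup>+y. \<integral>\<^sup>+c. \<integral>\<^sup>+c'. h (fst c + fst c', snd c + snd c') \<partial>gs_chain k P sub n y \<partial>?sub y \<partial>k x)"
    unfolding gs_chain_Suc
    by (subst nn_integral_bind[OF _ step]) (simp_all only: measurable_cnt nn_integral_cnt_conv[OF mem], simp)
  show "(AE c in gs_chain k P sub (Suc n) x. Q c) \<longleftrightarrow>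
      (AE y in k x. AE c in ?sub y. AE c' in gs_chain k P sub n y. Q (fst c + fst c', snd c + snd c'))"
    unfolding gs_chain_Suc
    by (subst AE_bind[OF step]) (simp_all only: measurable_cnt AE_cnt_conv[OF mem], simp)
qed

section \<open>Counts along a chain of moves\<close>

definition count_ok :: "nat \<Rightarrow> nat \<times> nat \<Rightarrow> bool" where
  "count_ok b c \<longleftrightarrow> fst c \<le> b \<and> snd c \<le> fst c"

text \<open>Each move contributes at most one subtree. Over the levels the factors multiply to
  \<open>s ^ (\<tau> - 1)\<close>, the bound \<open>B\<close> of the trials.\<close>

lemma AE_gs_chain_count_ok:
  assumes k: "k \<in> borel \<rightarrow>\<^sub>M prob_algebra borel" and P: "Measurable.pred borel P"
    and sub: "sub \<in> borel \<rightarrow>\<^sub>M prob_algebra cnt" and ok: "\<And>y. AE c in sub y. count_ok b c"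
  shows "AE c in gs_chain k P sub n x. count_ok (n * b) c"
proof (induction n arbitrary: x)
  case 0
  show ?case
    unfolding gs_chain.simps(1) by (subst AE_return) (auto simp: count_ok_def)
next
  case (Suc n)
  have "AE c in (if P y then sub y else return cnt (0, 0)). count_ok b c" for y
  proof (cases "P y")
    case False
    have "AE c in return cnt (0, 0). count_ok b c"
      by (subst AE_return) (auto simp: count_ok_def)
    then show ?thesis using False by simp
  qed (use ok[of y] in simp)
  moreover have "AE c' in gs_chain k P sub n y. count_ok (Suc n * b) (fst c + fst c', snd c + snd c')"
    if "count_ok b c" for c y
    using Suc[of y] by eventually_elim (use that in \<open>auto simp: count_ok_def\<close>)
  ultimately have "AE c in (if P y then sub y else return cnt (0, 0)). AE c' in gs_chain k P sub n y.
      count_ok (Suc n * b) (fst c + fst c', snd c + snd c')" for y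
    by (rule eventually_mono)
  then show ?case
    unfolding AE_gs_chain_Suc[OF k P sub] by (rule AE_I2)
qed

text \<open>Serves to show that the law of M does not depend on A. Quantifying over all
  \<open>g\<close> lets the induction absorb the count gathered so far by shifting
  \<open>g\<close>.\<close>

lemma gs_chain_fst_cong:
  assumes k: "k \<in> borel \<rightarrow>\<^sub>M prob_algebra borel" and P: "Measurable.pred borel P"
    and sub: "sub \<in> borel \<rightarrow>\<^sub>M prob_algebra cnt" and sub': "sub' \<in> borel \<rightarrow>\<^sub>M prob_algebra cnt"
    and eq: "\<And>y (g :: nat \<Rightarrow> ennreal). (\<integral>\<^sup>+c. g (fst c) \<partial>sub y) = (\<integral>\<^sup>+c. g (fst c) \<partial>sub' y)"
  shows "(\<integral>\<^sup>+c. g (fst c) \<partial>gs_chain k P sub n x) = (\<integral>\<^sup>+c. g (fst c) \<partial>gs_chain k P sub' n x)"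
proof (induction n arbitrary: x g)
  case (Suc n)
  have "(\<integral>\<^sup>+c. \<integral>\<^sup>+c'. g (fst c + fst c') \<partial>gs_chain k P sub n y \<partial>(if P y then sub y else return cnt (0, 0)))
      = (\<integral>\<^sup>+c. \<integral>\<^sup>+c'. g (fst c + fst c') \<partial>gs_chain k P sub' n y \<partial>(if P y then sub' y else return cnt (0, 0)))" for y
    unfolding Suc[where g = "\<lambda>n'. g (n + n')" for n]
    using eq[where y = y and g = "\<lambda>n0. \<integral>\<^sup>+c'. g (n0 + fst c') \<partial>gs_chain k P sub' n y"] by simp
  then show ?case
    unfolding nn_integral_gs_chain_Suc[OF k P sub] nn_integral_gs_chain_Suc[OF k P sub'] by simp
qed simp

text \<open>Stationarity makes each of the \<open>n\<close> moves contribute the same expected weight.\<close>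

lemma nn_integral_gs_chain_stationary:
  fixes w :: "nat \<times> nat \<Rightarrow> ennreal"
  assumes k: "k \<in> borel \<rightarrow>\<^sub>M prob_algebra borel" and P: "Measurable.pred borel P"
    and sub: "sub \<in> borel \<rightarrow>\<^sub>M prob_algebra cnt"
    and sets_q: "sets q = sets borel" and stat: "q \<bind> k = q"
    and w0: "w (0, 0) = 0" and w_add: "\<And>c c'. w (fst c + fst c', snd c + snd c') = w c + w c'"
  shows "(\<integral>\<^sup>+x. \<integral>\<^sup>+c. w c \<partial>gs_chain k P sub n x \<partial>q) =
    of_nat n * (\<integral>\<^sup>+y. (if P y then \<integral>\<^sup>+c. w c \<partial>sub y else 0) \<partial>q)"
proof (induction n)
  case 0
  then show ?case by (simp add: nn_integral_return w0)
next
  case (Suc n)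
  note [measurable_cong] = sets_q
  note chain = gs_chain_measurable[OF k P sub, of n]
  have meas: "(\<lambda>y. \<integral>\<^sup>+c. w c \<partial>D y) \<in> borel_measurable borel" if "D \<in> borel \<rightarrow>\<^sub>M prob_algebra cnt" for D
    by (rule measurable_compose[OF measurable_prob_algebraD[OF that] nn_integral_measurable_subprob_algebra]) simp
  note [measurable] = P meas[OF sub] meas[OF chain]
  let ?sub = "\<lambda>y. if P y then sub y else return cnt (0, 0)"
  have inner: "(\<integral>\<^sup>+c. \<integral>\<^sup>+c'. w (fst c + fst c', snd c + snd c') \<partial>gs_chain k P sub n y \<partial>?sub y)
      = (if P y then \<integral>\<^sup>+c. w c \<partial>sub y else 0) + (\<integral>\<^sup>+c. w c \<partial>gs_chain k P sub n y)" for y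
  proof -
    have mem: "?sub y \<in> space (prob_algebra cnt)" "gs_chain k P sub n y \<in> space (prob_algebra cnt)"
      using kernel_at[OF sub] kernel_at[OF chain] return_cnt_in_prob_algebra by simp_all
    then interpret D: prob_space "?sub y" + E: prob_space "gs_chain k P sub n y"
      by (auto simp: space_prob_algebra)
    have sets: "sets (?sub y) = sets cnt" "sets (gs_chain k P sub n y) = sets cnt"
      using mem by (auto simp: space_prob_algebra)
    have "(\<integral>\<^sup>+c'. w (fst c + fst c', snd c + snd c') \<partial>gs_chain k P sub n y)
        = w c + (\<integral>\<^sup>+c'. w c' \<partial>gs_chain k P sub n y)" for c
      unfolding w_add by (subst nn_integral_add) (simp_all add: measurable_cong_sets[OF sets(2) refl] E.emeasure_space_1)
    then have "(\<integral>\<^sup>+c. \<integral>\<^sup>+c'. w (fst c + fst c', snd c + snd c') \<partial>gs_chain k P sub n y \<partial>?sub y)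
        = (\<integral>\<^sup>+c. w c \<partial>?sub y) + (\<integral>\<^sup>+c. w c \<partial>gs_chain k P sub n y)"
      by (simp only:) (subst nn_integral_add, simp_all only: measurable_cong_sets[OF sets(1) refl], simp_all add: D.emeasure_space_1)
    then show ?thesis by (simp add: nn_integral_return w0)
  qed
  have "(\<integral>\<^sup>+x. \<integral>\<^sup>+c. w c \<partial>gs_chain k P sub (Suc n) x \<partial>q) =
      (\<integral>\<^sup>+x. \<integral>\<^sup>+y. (if P y then \<integral>\<^sup>+c. w c \<partial>sub y else 0) + (\<integral>\<^sup>+c. w c \<partial>gs_chain k P sub n y) \<partial>k x \<partial>q)"
    unfolding nn_integral_gs_chain_Suc[OF k P sub] inner ..
  \<comment> \<open>One move from \<open>q\<close> again has law \<open>q\<close>, so the subtree of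
    \<open>y\<close> and the rest of the chain can both be integrated against \<open>q\<close>. The
    chain continues from \<open>y\<close> whether or not \<open>y\<close> is kept, so no
    conditioning disturbs stationarity.\<close>
  also have "\<dots> = (\<integral>\<^sup>+y. (if P y then \<integral>\<^sup>+c. w c \<partial>sub y else 0) + (\<integral>\<^sup>+c. w c \<partial>gs_chain k P sub n y) \<partial>(q \<bind> k))"
    using measurable_prob_algebraD[OF k]
    by (intro nn_integral_bind[symmetric, where B = borel]) (simp_all add: measurable_cong_sets[OF sets_q refl])
  also have "\<dots> = (\<integral>\<^sup>+y. (if P y then \<integral>\<^sup>+c. w c \<partial>sub y else 0) \<partial>q)
      + (\<integral>\<^sup>+y. \<integral>\<^sup>+c. w c \<partial>gs_chain k P sub n y \<partial>q)"
    unfolding stat by (rule nn_integral_add) measurable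
  also have "\<dots> = of_nat (Suc n) * (\<integral>\<^sup>+y. (if P y then \<integral>\<^sup>+c. w c \<partial>sub y else 0) \<partial>q)"
    unfolding Suc by (simp add: algebra_simps)
  finally show ?case .
qed

lemma gs_desc_0: "gs_desc s S lev K A l 0 = (\<lambda>x. return cnt (1, if x \<in> A then 1 else 0))"
  by auto

lemma gs_desc_Suc: "gs_desc s S lev K A l (Suc r) =
    gs_chain (K l) (\<lambda>y. lev (Suc l) \<le> S y) (gs_desc s S lev K A (Suc l) r) s"
  by auto

section \<open>Expected counts under stationary kernels\<close>

locale splitting =
  fixes f :: "'a::euclidean_space \<Rightarrow> real" and S :: "'a \<Rightarrow> real" and gam :: real
    and s \<tau> :: nat and lev :: "nat \<Rightarrow> real" and K :: "nat \<Rightarrow> 'a \<Rightarrow> 'a measure"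
  assumes f_meas [measurable]: "f \<in> borel_measurable borel"
    and f_nonneg: "\<And>x. 0 \<le> f x"
    and f_int: "(\<integral>\<^sup>+x. ennreal (f x) \<partial>lborel) = 1"
    and S_meas [measurable]: "S \<in> borel_measurable borel"
    and rare_pos: "0 < measure (gs_dist f) {x. gam \<le> S x}"
    and s_pos: "1 \<le> s"
    and tau_ge: "1 \<le> \<tau>"
    and lev_mono: "\<And>l. 1 \<le> l \<Longrightarrow> l < \<tau> \<Longrightarrow> lev l < lev (Suc l)"
    and lev_top: "lev \<tau> = gam"
    and K_kernel: "\<And>l. l \<le> \<tau> \<Longrightarrow> K l \<in> borel \<rightarrow>\<^sub>M prob_algebra borel"
    and K_stat: "\<And>l. l \<le> \<tau> \<Longrightarrow> gs_target f S lev l \<bind> K l = gs_target f S lev l"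
begin

abbreviation "\<mu> \<equiv> gs_dist f"
abbreviation "desc \<equiv> gs_desc s S lev K"
abbreviation "trial \<equiv> gs_trial f s \<tau> S lev K"
abbreviation "nonempty \<equiv> gs_nonempty f s \<tau> S lev K"

lemma sets_\<mu> [simp, measurable_cong]: "sets \<mu> = sets borel"
  by (simp add: gs_dist_def)

sublocale \<mu>: prob_space \<mu>
proof
  show "emeasure \<mu> (space \<mu>) = 1"
    using f_int by (simp add: gs_dist_def emeasure_density cong: nn_integral_cong)
qed

lemma nn_integral_\<mu>:
  assumes "h \<in> borel_measurable borel"
  shows "(\<integral>\<^sup>+x. h x \<partial>\<mu>) = (\<integral>\<^sup>+x. ennreal (f x) * h x \<partial>lborel)"
  unfolding gs_dist_def by (rule nn_integral_density) (use assms in simp_all)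

lemma lev_le_gam: "1 \<le> l \<Longrightarrow> l \<le> \<tau> \<Longrightarrow> lev l \<le> gam"
proof (induction "\<tau> - l" arbitrary: l)
  case 0
  then show ?case using lev_top by simp
next
  case (Suc n)
  then have "lev (Suc l) \<le> gam" by (intro Suc.hyps(1)) auto
  moreover have "lev l < lev (Suc l)" using Suc by (intro lev_mono) auto
  ultimately show ?case by simp
qed

lemma level_prob_pos:
  assumes "1 \<le> l" "l \<le> \<tau>"
  shows "0 < measure \<mu> (gs_lvl S lev l)"
proof -
  have "measure \<mu> {x. gam \<le> S x} \<le> measure \<mu> (gs_lvl S lev l)"
  proof (rule \<mu>.finite_measure_mono)
    show "{x. gam \<le> S x} \<subseteq> gs_lvl S lev l"
      using lev_le_gam[OF assms] by (auto simp: gs_lvl_def)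
  qed (use assms in \<open>simp add: gs_lvl_def\<close>)
  then show ?thesis using rare_pos by simp
qed

text \<open>Keeps the level probability as a factor of the stationary law: stationarity can then be
  used on restrictions of \<open>\<mu>\<close>, and no quotients of successive level probabilities
  have to be telescoped.\<close>

lemma nn_integral_target:
  assumes l: "1 \<le> l" "l \<le> \<tau>" and h [measurable]: "h \<in> borel_measurable borel"
  shows "(\<integral>\<^sup>+x. h x * indicator {x. lev l \<le> S x} x \<partial>\<mu>)
    = ennreal (measure \<mu> (gs_lvl S lev l)) * (\<integral>\<^sup>+x. h x \<partial>gs_target f S lev l)"
proof -
  let ?p = "measure \<mu> (gs_lvl S lev l)"
  have lvl: "gs_lvl S lev l = {x. lev l \<le> S x}"
    using l by (simp add: gs_lvl_def)
  have p: "?p > 0" by (rule level_prob_pos[OF l])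
  have "ennreal ?p * (\<integral>\<^sup>+x. h x \<partial>gs_target f S lev l)
      = ennreal ?p * (\<integral>\<^sup>+x. ennreal (f x * indicator (gs_lvl S lev l) x / ?p) * h x \<partial>lborel)"
    unfolding gs_target_def by (subst nn_integral_density) (auto simp: lvl)
  also have "\<dots> = (\<integral>\<^sup>+x. ennreal ?p * (ennreal (f x * indicator (gs_lvl S lev l) x / ?p) * h x) \<partial>lborel)"
    by (rule nn_integral_cmult[symmetric]) (simp add: lvl)
  also have "\<dots> = (\<integral>\<^sup>+x. ennreal (f x) * (h x * indicator {x. lev l \<le> S x} x) \<partial>lborel)"
  proof (rule nn_integral_cong)
    fix x
    have "ennreal ?p * ennreal (f x * indicator (gs_lvl S lev l) x / ?p)
        = ennreal (f x) * indicator {x. lev l \<le> S x} x"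
      using p f_nonneg[of x] by (simp add: lvl indicator_def flip: ennreal_mult)
    then show "ennreal ?p * (ennreal (f x * indicator (gs_lvl S lev l) x / ?p) * h x)
        = ennreal (f x) * (h x * indicator {x. lev l \<le> S x} x)"
      by (simp only: mult.assoc[symmetric]) (simp only: mult_ac)
  qed
  also have "\<dots> = (\<integral>\<^sup>+x. h x * indicator {x. lev l \<le> S x} x \<partial>\<mu>)"
    by (rule nn_integral_\<mu>[symmetric]) measurable
  finally show ?thesis ..
qed

lemma level_pred [measurable]: "Measurable.pred borel (\<lambda>y. lev l \<le> S y)"
  by measurable

lemma desc_measurable:
  assumes [measurable]: "A \<in> sets borel"
  shows "l + r \<le> \<tau> \<Longrightarrow> desc A l r \<in> borel \<rightarrow>\<^sub>M prob_algebra cnt"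
proof (induction r arbitrary: l)
  case 0
  have "(\<lambda>x. (1::nat, if x \<in> A then 1 else 0::nat)) \<in> borel \<rightarrow>\<^sub>M cnt"
    unfolding cnt_def by measurable
  then show ?case
    unfolding gs_desc_0 by (rule measurable_compose[OF _ measurable_return_prob_space])
next
  case (Suc r)
  then show ?case
    unfolding gs_desc_Suc by (intro gs_chain_measurable K_kernel level_pred) auto
qed

lemma AE_desc_count_ok:
  assumes A: "A \<in> sets borel"
  shows "l + r \<le> \<tau> \<Longrightarrow> AE c in desc A l r x. count_ok (s ^ r) c"
proof (induction r arbitrary: l x)
  case 0
  show ?case
    unfolding gs_desc_0 by (subst AE_return) (auto simp: count_ok_def)
next
  case (Suc r)
  then show ?case
    unfolding gs_desc_Suc power_Suc
    by (intro AE_gs_chain_count_ok K_kernel level_pred desc_measurable[OF A]) auto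
qed

lemma desc_fst_cong:
  fixes g :: "nat \<Rightarrow> ennreal"
  assumes A: "A \<in> sets borel" and A': "A' \<in> sets borel"
  shows "l + r \<le> \<tau> \<Longrightarrow> (\<integral>\<^sup>+c. g (fst c) \<partial>desc A l r x) = (\<integral>\<^sup>+c. g (fst c) \<partial>desc A' l r x)"
proof (induction r arbitrary: l x g)
  case 0
  show ?case
    unfolding gs_desc_0 by (subst (1 2) nn_integral_return) auto
next
  case (Suc r)
  then show ?case
    unfolding gs_desc_Suc
    by (intro gs_chain_fst_cong K_kernel level_pred desc_measurable[OF A] desc_measurable[OF A']) auto
qed

text \<open>From \<open>\<mu>\<close> restricted to one level, the \<open>s\<close> stationary moves
  multiply the expected weight by \<open>s\<close> and shrink the restriction to the next level. The
  two count components are the weights used; their ratio gives Q(A).\<close>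

lemma nn_integral_desc:
  fixes w :: "nat \<times> nat \<Rightarrow> ennreal"
  assumes A: "A \<in> sets borel"
    and w0: "w (0, 0) = 0" and w_add: "\<And>c c'. w (fst c + fst c', snd c + snd c') = w c + w c'"
  shows "1 \<le> l \<Longrightarrow> l + r = \<tau> \<Longrightarrow>
    (\<integral>\<^sup>+x. (\<integral>\<^sup>+c. w c \<partial>desc A l r x) * indicator {x. lev l \<le> S x} x \<partial>\<mu>)
    = of_nat (s ^ r) * (\<integral>\<^sup>+x. w (1, if x \<in> A then 1 else 0) * indicator {x. gam \<le> S x} x \<partial>\<mu>)"
proof (induction r arbitrary: l)
  case 0
  then show ?case
    unfolding gs_desc_0 using lev_top by (simp add: nn_integral_return)
next
  case (Suc r)
  have l: "1 \<le> l" "l \<le> \<tau>" "Suc l + r = \<tau>" "Suc l + r \<le> \<tau>" "l < \<tau>" using Suc.prems by auto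
  note sub = desc_measurable[OF A l(4)]
  have meas: "(\<lambda>x. \<integral>\<^sup>+c. w c \<partial>D x) \<in> borel_measurable borel" if "D \<in> borel \<rightarrow>\<^sub>M prob_algebra cnt" for D
    by (rule measurable_compose[OF measurable_prob_algebraD[OF that] nn_integral_measurable_subprob_algebra]) simp
  note [measurable] = meas[OF sub]
  let ?D = "\<lambda>x. \<integral>\<^sup>+c. w c \<partial>desc A (Suc l) r x"
  let ?q = "gs_target f S lev l" and ?p = "ennreal (measure \<mu> (gs_lvl S lev l))"
  have "(\<integral>\<^sup>+x. (\<integral>\<^sup>+c. w c \<partial>desc A l (Suc r) x) * indicator {x. lev l \<le> S x} x \<partial>\<mu>)
      = ?p * (\<integral>\<^sup>+x. \<integral>\<^sup>+c. w c \<partial>desc A l (Suc r) x \<partial>?q)"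
    by (intro nn_integral_target l meas desc_measurable[OF A]) (use Suc.prems in simp)
  also have "(\<integral>\<^sup>+x. \<integral>\<^sup>+c. w c \<partial>desc A l (Suc r) x \<partial>?q)
      = of_nat s * (\<integral>\<^sup>+y. (if lev (Suc l) \<le> S y then ?D y else 0) \<partial>?q)"
    unfolding gs_desc_Suc
    by (rule nn_integral_gs_chain_stationary)
      (use K_kernel K_stat l sub w0 w_add in \<open>auto simp: gs_target_def\<close>)
  also have "?p * (of_nat s * (\<integral>\<^sup>+y. (if lev (Suc l) \<le> S y then ?D y else 0) \<partial>?q))
      = of_nat s * (?p * (\<integral>\<^sup>+y. (if lev (Suc l) \<le> S y then ?D y else 0) \<partial>?q))"
    by (simp add: mult_ac)
  also have "?p * (\<integral>\<^sup>+y. (if lev (Suc l) \<le> S y then ?D y else 0) \<partial>?q)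
      = (\<integral>\<^sup>+y. (if lev (Suc l) \<le> S y then ?D y else 0) * indicator {x. lev l \<le> S x} y \<partial>\<mu>)"
    by (rule nn_integral_target[symmetric]) (use l in measurable)
  \<comment> \<open>Levels are nested, so the restriction to level \<open>Suc l\<close> absorbs the
    one to level \<open>l\<close>.\<close>
  also have "\<dots> = (\<integral>\<^sup>+y. ?D y * indicator {x. lev (Suc l) \<le> S x} y \<partial>\<mu>)"
    using lev_mono[OF l(1) l(5)] by (intro nn_integral_cong) (auto simp: indicator_def)
  also have "\<dots> = of_nat (s ^ r) * (\<integral>\<^sup>+x. w (1, if x \<in> A then 1 else 0) * indicator {x. gam \<le> S x} x \<partial>\<mu>)"
    by (rule Suc.IH) (use l in auto)
  finally show ?case by (simp add: mult.assoc)
qed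

context
  fixes A :: "'a set"
  assumes A [measurable]: "A \<in> sets borel"
begin

private abbreviation "step \<equiv> \<lambda>y. if lev 1 \<le> S y then desc A 1 (\<tau> - 1) y else return cnt (0, 0)"

private lemma step_measurable: "step \<in> borel \<rightarrow>\<^sub>M prob_algebra cnt"
proof -
  have [measurable]: "desc A 1 (\<tau> - 1) \<in> borel \<rightarrow>\<^sub>M prob_algebra cnt"
    by (rule desc_measurable[OF A]) (use tau_ge in simp)
  have [measurable]: "(\<lambda>y. return cnt (0, 0)) \<in> borel \<rightarrow>\<^sub>M prob_algebra cnt"
    by (simp add: return_cnt_in_prob_algebra)
  show ?thesis by measurable
qed

private lemma step_subprob: "step \<in> \<mu> \<rightarrow>\<^sub>M subprob_algebra cnt"
  unfolding measurable_cong_sets[OF sets_\<mu> refl]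
  by (rule measurable_prob_algebraD[OF step_measurable])

lemma trial_in_prob_algebra: "trial A \<in> space (prob_algebra cnt)"
proof -
  have \<mu>: "\<mu> \<in> space (prob_algebra borel)"
    by (simp add: space_prob_algebra \<mu>.prob_space_axioms)
  show ?thesis
    unfolding gs_trial_def space_prob_algebra mem_Collect_eq
    by (intro conjI prob_space_bind'[OF \<mu> step_measurable] sets_bind'[OF \<mu> step_measurable])
qed

lemma nn_integral_trial: "(\<integral>\<^sup>+c. h c \<partial>trial A) = (\<integral>\<^sup>+y. \<integral>\<^sup>+c. h c \<partial>step y \<partial>\<mu>)"
  unfolding gs_trial_def by (rule nn_integral_bind[OF _ step_subprob]) simp

lemma AE_trial_count_ok: "AE c in trial A. count_ok (s ^ (\<tau> - 1)) c"
proof -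
  have "AE c in step y. count_ok (s ^ (\<tau> - 1)) c" for y
  proof (cases "lev 1 \<le> S y")
    case True
    then show ?thesis using AE_desc_count_ok[OF A, of 1 "\<tau> - 1" y] tau_ge by simp
  next
    case False
    have "AE c in return cnt (0, 0). count_ok (s ^ (\<tau> - 1)) c"
      by (subst AE_return) (auto simp: count_ok_def)
    then show ?thesis using False by simp
  qed
  then show ?thesis
    unfolding gs_trial_def by (subst AE_bind[OF step_subprob]) auto
qed

lemma nn_integral_trial_additive:
  fixes w :: "nat \<times> nat \<Rightarrow> ennreal"
  assumes w0: "w (0, 0) = 0" and w_add: "\<And>c c'. w (fst c + fst c', snd c + snd c') = w c + w c'"
  shows "(\<integral>\<^sup>+c. w c \<partial>trial A)
    = of_nat (s ^ (\<tau> - 1)) * (\<integral>\<^sup>+x. w (1, if x \<in> A then 1 else 0) * indicator {x. gam \<le> S x} x \<partial>\<mu>)"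
proof -
  have "(\<integral>\<^sup>+c. w c \<partial>trial A) = (\<integral>\<^sup>+x. (\<integral>\<^sup>+c. w c \<partial>desc A 1 (\<tau> - 1) x) * indicator {x. lev 1 \<le> S x} x \<partial>\<mu>)"
    unfolding nn_integral_trial by (intro nn_integral_cong) (auto simp: nn_integral_return w0)
  also have "\<dots> = of_nat (s ^ (\<tau> - 1)) * (\<integral>\<^sup>+x. w (1, if x \<in> A then 1 else 0) * indicator {x. gam \<le> S x} x \<partial>\<mu>)"
    by (rule nn_integral_desc[OF A w0 w_add]) (use tau_ge in simp_all)
  finally show ?thesis .
qed

lemma nn_integral_trial_fst:
  "(\<integral>\<^sup>+c. of_nat (fst c) \<partial>trial A) = of_nat (s ^ (\<tau> - 1)) * emeasure \<mu> {x. gam \<le> S x}"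
  using nn_integral_trial_additive[of "\<lambda>c. of_nat (fst c)"] by simp

lemma nn_integral_trial_snd:
  "(\<integral>\<^sup>+c. of_nat (snd c) \<partial>trial A) = of_nat (s ^ (\<tau> - 1)) * emeasure \<mu> (A \<inter> {x. gam \<le> S x})"
proof -
  have "(\<integral>\<^sup>+x. of_nat (if x \<in> A then 1 else 0) * indicator {x. gam \<le> S x} x \<partial>\<mu>)
      = (\<integral>\<^sup>+x. indicator (A \<inter> {x. gam \<le> S x}) x \<partial>\<mu>)"
    by (intro nn_integral_cong) (auto simp: indicator_def)
  then show ?thesis
    using nn_integral_trial_additive[of "\<lambda>c. of_nat (snd c)"] by simp
qed

lemma sets_trial: "sets (trial A) = sets cnt"
  using trial_in_prob_algebra by (simp add: space_prob_algebra)

lemma prob_space_trial: "prob_space (trial A)"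
  using trial_in_prob_algebra by (simp add: space_prob_algebra)

text \<open>Almost surely empty trials would have mean size 0, whereas the mean is
  \<open>s ^ (\<tau> - 1)\<close> times the positive rare-event probability. Conditioning on
  nonemptiness is therefore legitimate.\<close>

lemma emeasure_nonempty_pos: "emeasure (trial A) {c. 1 \<le> fst c} \<noteq> 0"
proof
  assume "emeasure (trial A) {c. 1 \<le> fst c} = 0"
  then have "AE c in trial A. \<not> 1 \<le> fst c"
    by (intro AE_I[where N = "{c. 1 \<le> fst c}"]) (auto simp: sets_trial)
  then have "(\<integral>\<^sup>+c. of_nat (fst c) \<partial>trial A) = (\<integral>\<^sup>+c. 0 \<partial>trial A)"
    by (intro nn_integral_cong_AE) (auto elim!: eventually_mono)
  then show False
    unfolding nn_integral_trial_fst using s_pos rare_pos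
    by (simp add: \<mu>.emeasure_eq_measure)
qed

lemma nn_integral_nonempty:
  "(\<integral>\<^sup>+c. h c \<partial>nonempty A)
    = (\<integral>\<^sup>+c. h c * indicator {c. 1 \<le> fst c} c \<partial>trial A) / emeasure (trial A) {c. 1 \<le> fst c}"
  unfolding gs_nonempty_def
  by (rule nn_integral_uniform_measure) (simp_all add: measurable_cong_sets[OF sets_trial refl] sets_trial)

lemma iid_trials_nonempty: "iid_trials (nonempty A) (s ^ (\<tau> - 1))"
proof -
  interpret T: prob_space "trial A" by (rule prob_space_trial)
  show ?thesis
  proof (intro iid_trials.intro iid_trials_axioms.intro)
    show "prob_space (nonempty A)"
      unfolding gs_nonempty_def
      by (rule prob_space_uniform_measure) (use emeasure_nonempty_pos in simp_all)
    show "sets (nonempty A) = sets (count_space UNIV)"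
      by (simp add: gs_nonempty_def sets_trial)
    show "AE c in nonempty A. 1 \<le> fst c \<and> fst c \<le> s ^ (\<tau> - 1) \<and> snd c \<le> fst c"
      unfolding gs_nonempty_def
    proof (rule AE_uniform_measureI)
      show "AE c in trial A. c \<in> {c. 1 \<le> fst c} \<longrightarrow>
          1 \<le> fst c \<and> fst c \<le> s ^ (\<tau> - 1) \<and> snd c \<le> fst c"
        using AE_trial_count_ok by eventually_elim (simp add: count_ok_def)
    qed (simp add: sets_trial)
  qed
qed

text \<open>Empty trials contribute to neither count, as \<open>snd c \<le> fst c\<close> almost
  surely. Conditioning thus divides both means by the same probability and preserves their
  ratio.\<close>

lemma unbiased:
  "(\<integral>c. real (snd c) \<partial>nonempty A) = gs_Q f S gam A * (\<integral>c. real (fst c) \<partial>nonempty A)"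
proof -
  interpret N: iid_trials "nonempty A" "s ^ (\<tau> - 1)" by (rule iid_trials_nonempty)
  let ?e = "emeasure (trial A) {c. 1 \<le> fst c}"
  have Q: "ennreal (gs_Q f S gam A) * emeasure \<mu> {x. gam \<le> S x} = emeasure \<mu> (A \<inter> {x. gam \<le> S x})"
    unfolding gs_Q_def \<mu>.emeasure_eq_measure using rare_pos
    by (simp add: flip: ennreal_mult)
  have "(\<integral>\<^sup>+c. of_nat (snd c) * indicator {c. 1 \<le> fst c} c \<partial>trial A) = (\<integral>\<^sup>+c. of_nat (snd c) \<partial>trial A)"
  proof (rule nn_integral_cong_AE)
    show "AE c in trial A. of_nat (snd c) * indicator {c. 1 \<le> fst c} c = (of_nat (snd c) :: ennreal)"
      using AE_trial_count_ok by eventually_elim (auto simp: count_ok_def indicator_def)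
  qed
  then have "(\<integral>\<^sup>+c. of_nat (snd c) \<partial>nonempty A) = (\<integral>\<^sup>+c. of_nat (snd c) \<partial>trial A) / ?e"
    unfolding nn_integral_nonempty by simp
  also have "\<dots> = ennreal (gs_Q f S gam A) * ((\<integral>\<^sup>+c. of_nat (fst c) \<partial>trial A) / ?e)"
    unfolding nn_integral_trial_fst nn_integral_trial_snd Q[symmetric]
    by (simp add: divide_ennreal_def mult_ac)
  also have "(\<integral>\<^sup>+c. of_nat (fst c) \<partial>trial A) / ?e = (\<integral>\<^sup>+c. of_nat (fst c) \<partial>nonempty A)"
    unfolding nn_integral_nonempty
    by (intro arg_cong[where f = "\<lambda>x. x / ?e"] nn_integral_cong) (auto simp: indicator_def)
  finally have "(\<integral>\<^sup>+c. ennreal (real (snd c)) \<partial>nonempty A)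
      = ennreal (gs_Q f S gam A) * (\<integral>\<^sup>+c. ennreal (real (fst c)) \<partial>nonempty A)"
    by (simp add: ennreal_of_nat_eq_real_of_nat)
  then show ?thesis
    by (simp add: integral_eq_nn_integral enn2real_mult gs_Q_def)
qed

end

lemma nonempty_fst_cong:
  fixes g :: "nat \<Rightarrow> ennreal"
  assumes A: "A \<in> sets borel" and A': "A' \<in> sets borel"
  shows "(\<integral>\<^sup>+c. g (fst c) \<partial>nonempty A) = (\<integral>\<^sup>+c. g (fst c) \<partial>nonempty A')"
proof -
  have trial: "(\<integral>\<^sup>+c. g (fst c) \<partial>trial A) = (\<integral>\<^sup>+c. g (fst c) \<partial>trial A')" for g :: "nat \<Rightarrow> ennreal"
    unfolding nn_integral_trial[OF A] nn_integral_trial[OF A']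
    using desc_fst_cong[OF A A', where l = 1 and r = "\<tau> - 1" and g = g] tau_ge
    by (intro nn_integral_cong) auto
  have ind: "indicator {n. 1 \<le> n} (fst c) = (indicator {c. 1 \<le> fst c} c :: ennreal)"
    for c :: "nat \<times> nat"
    by (simp add: indicator_def)
  \<comment> \<open>An indicator as test function shows that the normalising constants agree
    too.\<close>
  have "emeasure (trial A) {c. 1 \<le> fst c} = emeasure (trial A') {c. 1 \<le> fst c}"
    using trial[of "indicator {n. 1 \<le> n}"] unfolding ind
    by (subst (asm) (1 2) nn_integral_indicator) (simp_all add: sets_trial[OF A] sets_trial[OF A'])
  then show ?thesis
    unfolding nn_integral_nonempty[OF A] nn_integral_nonempty[OF A']
    using trial[of "\<lambda>n. g n * indicator {n. 1 \<le> n} n"] unfolding ind by simp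
qed

text \<open>Lets the bounds obtained for a given A be stated with moments defined through
  \<open>UNIV\<close>.\<close>

lemma gs_moment_eq:
  assumes A: "A \<in> sets borel"
  shows "gs_moment f s \<tau> S lev K k = (\<integral>c. real (fst c) ^ k \<partial>nonempty A)"
proof -
  interpret N: iid_trials "nonempty A" "s ^ (\<tau> - 1)" by (rule iid_trials_nonempty[OF A])
  interpret U: iid_trials "nonempty UNIV" "s ^ (\<tau> - 1)" by (rule iid_trials_nonempty) simp
  show ?thesis
    unfolding gs_moment_def
    using nonempty_fst_cong[of UNIV A "\<lambda>n. ennreal (real n ^ k)"] A
    by (simp add: integral_eq_nn_integral)
qed

lemma gs_Q_bounds: "A \<in> sets borel \<Longrightarrow> 0 \<le> gs_Q f S gam A" "A \<in> sets borel \<Longrightarrow> gs_Q f S gam A \<le> 1"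
proof -
  assume [measurable]: "A \<in> sets borel"
  have "measure \<mu> (A \<inter> {x. gam \<le> S x}) \<le> measure \<mu> {x. gam \<le> S x}"
    by (rule \<mu>.finite_measure_mono) auto
  then show "gs_Q f S gam A \<le> 1"
    using rare_pos by (simp add: gs_Q_def)
qed (simp add: gs_Q_def)

end

theorem theorem2:
  fixes f :: "'a::euclidean_space \<Rightarrow> real" and S :: "'a \<Rightarrow> real" and gam :: real
    and s \<tau> :: nat and lev :: "nat \<Rightarrow> real" and K :: "nat \<Rightarrow> 'a \<Rightarrow> 'a measure" and t :: nat
  assumes f_meas: "f \<in> borel_measurable borel"
    and f_nonneg: "\<And>x. 0 \<le> f x"
    and f_int: "(\<integral>\<^sup>+x. ennreal (f x) \<partial>lborel) = 1"
    and S_meas: "S \<in> borel_measurable borel"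
    and rare_pos: "0 < measure (gs_dist f) {x. gam \<le> S x}"
    and s_ge: "2 \<le> s"
    and tau_ge: "1 \<le> \<tau>"
    and lev_mono: "\<And>l. 1 \<le> l \<Longrightarrow> l < \<tau> \<Longrightarrow> lev l < lev (Suc l)"
    and lev_top: "lev \<tau> = gam"
    and K_kernel: "\<And>l. l \<le> \<tau> \<Longrightarrow> K l \<in> borel \<rightarrow>\<^sub>M prob_algebra borel"
    and K_stat: "\<And>l. l \<le> \<tau> \<Longrightarrow> gs_target f S lev l \<bind> K l = gs_target f S lev l"
    and t_pos: "1 \<le> t"
  shows
    "(\<forall>A \<in> sets borel.
        \<bar>(\<integral>\<omega>. thr_est \<omega> t \<partial>gs_seq f s \<tau> S lev K A) - gs_Q f S gam A\<bar>
        \<le> sqrt (4/3 * gs_moment f s \<tau> S lev K 3 * gs_moment f s \<tau> S lev K 2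
                 * (gs_moment f s \<tau> S lev K 1 + gs_moment f s \<tau> S lev K 2 / real t))
            / gs_moment f s \<tau> S lev K 1 ^ 3
          * (real t / gs_moment f s \<tau> S lev K 1) powr (-3/2))
   \<and> (\<forall>A \<in> sets borel.
        (\<integral>\<omega>. \<bar>thr_est \<omega> t - gs_Q f S gam A\<bar> \<partial>gs_seq f s \<tau> S lev K A)
        \<le> (sqrt (gs_moment f s \<tau> S lev K 2) / gs_moment f s \<tau> S lev K 1
             + gs_moment f s \<tau> S lev K 2
               / (gs_moment f s \<tau> S lev K 1 powr (3/2) * sqrt (real t)))
          * (real t / gs_moment f s \<tau> S lev K 1) powr (-1/2))
   \<and> (\<exists>B. \<forall>t'::nat. 1 \<le> t' \<longrightarrow>
        sqrt (4/3 * gs_moment f s \<tau> S lev K 3 * gs_moment f s \<tau> S lev K 2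
                 * (gs_moment f s \<tau> S lev K 1 + gs_moment f s \<tau> S lev K 2 / real t'))
            / gs_moment f s \<tau> S lev K 1 ^ 3 \<le> B
      \<and> sqrt (gs_moment f s \<tau> S lev K 2) / gs_moment f s \<tau> S lev K 1
             + gs_moment f s \<tau> S lev K 2
               / (gs_moment f s \<tau> S lev K 1 powr (3/2) * sqrt (real t')) \<le> B)"
proof (intro conjI ballI)
  interpret splitting f S gam s \<tau> lev K
    by (rule splitting.intro) (use assms in auto)
  let ?M = "gs_moment f s \<tau> S lev K"
  {
    fix A :: "'a set" assume A: "A \<in> sets borel"
    interpret N: iid_trials "nonempty A" "s ^ (\<tau> - 1)" by (rule iid_trials_nonempty[OF A])
    have mom: "N.mom = ?M"
      by (rule ext) (simp only: N.mom_eq gs_moment_eq[OF A])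
    note hyps = gs_Q_bounds[OF A] t_pos unbiased[OF A]
    show "\<bar>(\<integral>\<omega>. thr_est \<omega> t \<partial>gs_seq f s \<tau> S lev K A) - gs_Q f S gam A\<bar>
        \<le> sqrt (4/3 * ?M 3 * ?M 2 * (?M 1 + ?M 2 / real t)) / ?M 1 ^ 3 * (real t / ?M 1) powr (-3/2)"
      using N.bias_bound[OF hyps] unfolding mom gs_seq_def .
    show "(\<integral>\<omega>. \<bar>thr_est \<omega> t - gs_Q f S gam A\<bar> \<partial>gs_seq f s \<tau> S lev K A)
        \<le> (sqrt (?M 2) / ?M 1 + ?M 2 / (?M 1 powr (3/2) * sqrt (real t))) * (real t / ?M 1) powr (-1/2)"
      using N.mean_abs_error_bound[OF hyps] unfolding mom gs_seq_def .
  }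
  interpret N: iid_trials "nonempty UNIV" "s ^ (\<tau> - 1)" by (rule iid_trials_nonempty) simp
  have "N.mom = ?M"
    by (rule ext) (simp only: N.mom_eq gs_moment_def)
  then have M: "?M k \<ge> 0" "?M 1 \<ge> 1" for k
    using N.mom_nonneg N.mom_1_ge by auto
  \<comment> \<open>Both constants decrease in the threshold, so their values at 1 bound
    them.\<close>
  let ?B1 = "sqrt (4/3 * ?M 3 * ?M 2 * (?M 1 + ?M 2)) / ?M 1 ^ 3"
  let ?B2 = "sqrt (?M 2) / ?M 1 + ?M 2 / ?M 1 powr (3/2)"
  have "sqrt (4/3 * ?M 3 * ?M 2 * (?M 1 + ?M 2 / real t')) / ?M 1 ^ 3 \<le> ?B1" if "1 \<le> t'" for t' :: nat
    using M that divide_left_mono[of 1 "real t'" "?M 2"]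
    by (intro divide_right_mono real_sqrt_le_mono mult_left_mono add_left_mono) auto
  moreover have "sqrt (?M 2) / ?M 1 + ?M 2 / (?M 1 powr (3/2) * sqrt (real t')) \<le> ?B2"
    if "1 \<le> t'" for t' :: nat
  proof -
    have "?M 1 powr (3/2) > 0" using M(2) by simp
    moreover from this have "?M 1 powr (3/2) * 1 \<le> ?M 1 powr (3/2) * sqrt (real t')"
      using that by (intro mult_left_mono) auto
    ultimately show ?thesis
      using M(1)[of 2] by (intro add_left_mono divide_left_mono) (auto intro!: mult_pos_pos simp: that)
  qed
  ultimately show "\<exists>B. \<forall>t'::nat. 1 \<le> t' \<longrightarrow>
        sqrt (4/3 * ?M 3 * ?M 2 * (?M 1 + ?M 2 / real t')) / ?M 1 ^ 3 \<le> B
      \<and> sqrt (?M 2) / ?M 1 + ?M 2 / (?M 1 powr (3/2) * sqrt (real t')) \<le> B"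
    by (intro exI[of _ "max ?B1 ?B2"]) (auto simp: le_max_iff_disj)
qed

end
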